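(* (Encoding Theorem) There is an algorithm that takes as input a finite presentation $\langle A\mid R\rangle$ for a group $G$ and a word $w\in F(A)$ and outputs a finite presentation for a group $G_w$ such that $$\widehat{G}_w\cong 1 \iff w=_{\widehat{G}}1 .$$
   Context: $F(A)$ denotes the free group on the set $A$. For a group $G$, $\widehat{G}$ denotes its profinite completion (the inverse limit of the finite quotients of $G$). For $G=\langle A\mid R\rangle$ and $w\in F(A)$, the notation $w=_{\widehat{G}}1$ means that the image of $w$ under $F(A)\to G\to\widehat{G}$ is trivial, i.e. $w$ has trivial image in every finite quotient of $G$. *)

theory Defs
  imports "HOL-Algebra.Product_Groups" "HOL-Library.Nat_Bijection"
begin

section \<open>Free groups\<close>

text \<open>
  The letter \<open>(a, True)\<close> stands for the generator \<open>a\<close>, and \<open>(a, False)\<close> for its inverse.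
\<close>

type_synonym 'a letter = "'a \<times> bool"
type_synonym 'a word = "'a letter list"

definition inv_letter :: "'a letter \<Rightarrow> 'a letter"
  where "inv_letter x = (fst x, \<not> snd x)"

definition words :: "'a set \<Rightarrow> 'a word set"
  where "words A = lists (A \<times> UNIV)"

definition reduced :: "'a word \<Rightarrow> bool"
  where "reduced = successively (\<lambda>x y. y \<noteq> inv_letter x)"

fun cons_reduce :: "'a letter \<Rightarrow> 'a word \<Rightarrow> 'a word" where
  "cons_reduce x [] = [x]"
| "cons_reduce x (y # ys) = (if y = inv_letter x then ys else x # y # ys)"

definition reduce :: "'a word \<Rightarrow> 'a word"
  where "reduce w = foldr cons_reduce w []"

definition free_group :: "'a set \<Rightarrow> 'a word monoid"
  where "free_group A =
    \<lparr>carrier = {w \<in> words A. reduced w}, monoid.mult = (\<lambda>u v. reduce (u @ v)), one = []\<rparr>"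

lemma inv_letter_inv_letter [simp]: "inv_letter (inv_letter x) = x"
  by (simp add: inv_letter_def)

lemma reduced_Nil [simp]: "reduced []"
  by (simp add: reduced_def)

lemma reduced_Cons: "reduced (x # w) \<longleftrightarrow> (w = [] \<or> hd w \<noteq> inv_letter x) \<and> reduced w"
  by (cases w) (auto simp: reduced_def)

lemma reduced_cons_reduce: "reduced w \<Longrightarrow> reduced (cons_reduce x w)"
  by (cases w) (auto simp: reduced_Cons)

lemma cons_reduce_cancel: "reduced w \<Longrightarrow> cons_reduce (inv_letter x) (cons_reduce x w) = w"
  by (cases w rule: list.exhaust; cases "tl w") (auto simp: reduced_Cons)

lemma reduce_Nil [simp]: "reduce [] = []"
  by (simp add: reduce_def)

lemma reduce_Cons: "reduce (x # w) = cons_reduce x (reduce w)"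
  by (simp add: reduce_def)

lemma reduced_reduce: "reduced (reduce w)"
  by (induction w) (auto simp: reduce_Cons reduced_cons_reduce)

lemma reduce_reduced: "reduced w \<Longrightarrow> reduce w = w"
proof (induction w)
  case (Cons x w)
  then show ?case by (cases w) (auto simp: reduce_Cons reduced_Cons)
qed simp

lemma reduce_append_right: "reduce (u @ reduce v) = reduce (u @ v)"
  by (induction u) (auto simp: reduce_Cons reduce_reduced reduced_reduce)

lemma reduce_cons_reduce_append: "reduce (cons_reduce x u @ v) = cons_reduce x (reduce (u @ v))"
proof (cases u)
  case (Cons y ys)
  then show ?thesis
    using cons_reduce_cancel[OF reduced_reduce, of "inv_letter x" "ys @ v"]
    by (auto simp: reduce_Cons)
qed (simp add: reduce_Cons)

lemma reduce_append_left: "reduce (reduce u @ v) = reduce (u @ v)"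
  by (induction u) (auto simp: reduce_Cons reduce_cons_reduce_append)

lemma reduce_inverse_append: "reduce (map inv_letter (rev w) @ w) = []"
proof (induction w)
  case (Cons x w)
  have "reduce (map inv_letter (rev (x # w)) @ x # w)
      = reduce (map inv_letter (rev w) @ reduce (inv_letter x # x # w))"
    by (simp add: reduce_append_right)
  also have "reduce (inv_letter x # x # w) = reduce w"
    by (simp add: reduce_Cons cons_reduce_cancel reduced_reduce)
  finally show ?case using Cons by (simp add: reduce_append_right)
qed simp

lemma cons_reduce_in_words: "x \<in> A \<times> UNIV \<Longrightarrow> w \<in> words A \<Longrightarrow> cons_reduce x w \<in> words A"
  by (cases w) (auto simp: words_def)

lemma reduce_in_words: "w \<in> words A \<Longrightarrow> reduce w \<in> words A"
proof (induction w)
  case (Cons x w)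
  then show ?case unfolding reduce_Cons
    by (intro cons_reduce_in_words) (auto simp: words_def)
qed simp

lemma reduce_in_free_group: "w \<in> words A \<Longrightarrow> reduce w \<in> carrier (free_group A)"
  by (simp add: free_group_def reduce_in_words reduced_reduce)

lemma group_free_group: "group (free_group A)"
proof (rule groupI)
  fix u v w
  assume u: "u \<in> carrier (free_group A)" and v: "v \<in> carrier (free_group A)"
    and w: "w \<in> carrier (free_group A)"
  have "u @ v \<in> words A" using u v by (auto simp: free_group_def words_def)
  then show "u \<otimes>\<^bsub>free_group A\<^esub> v \<in> carrier (free_group A)"
    using reduce_in_free_group by (fastforce simp: free_group_def)
  show "u \<otimes>\<^bsub>free_group A\<^esub> v \<otimes>\<^bsub>free_group A\<^esub> w = u \<otimes>\<^bsub>free_group A\<^esub> (v \<otimes>\<^bsub>free_group A\<^esub> w)"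
    by (simp add: free_group_def reduce_append_left reduce_append_right)
next
  fix u assume u: "u \<in> carrier (free_group A)"
  show "\<one>\<^bsub>free_group A\<^esub> \<otimes>\<^bsub>free_group A\<^esub> u = u"
    using u by (simp add: free_group_def reduce_reduced)
  have "map inv_letter (rev u) \<in> words A"
    using u by (force simp: free_group_def words_def inv_letter_def)
  then have "reduce (map inv_letter (rev u)) \<in> carrier (free_group A)"
    by (rule reduce_in_free_group)
  moreover have "reduce (map inv_letter (rev u)) \<otimes>\<^bsub>free_group A\<^esub> u = \<one>\<^bsub>free_group A\<^esub>"
    by (simp add: free_group_def reduce_append_left reduce_inverse_append)
  ultimately show "\<exists>v\<in>carrier (free_group A). v \<otimes>\<^bsub>free_group A\<^esub> u = \<one>\<^bsub>free_group A\<^esub>"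
    by blast
qed (simp add: free_group_def words_def)


section \<open>Presentations\<close>

definition normal_closure :: "('a, 'b) monoid_scheme \<Rightarrow> 'a set \<Rightarrow> 'a set"
  where "normal_closure G S = \<Inter> {N. N \<lhd> G \<and> S \<subseteq> N}"

text \<open>Relators need not be freely reduced; each word denotes the element \<open>reduce w\<close> of \<open>F(A)\<close>.\<close>

definition relator_subgroup :: "'a set \<Rightarrow> 'a word set \<Rightarrow> 'a word set"
  where "relator_subgroup A R = normal_closure (free_group A) (reduce ` R)"

definition presented_group :: "'a set \<Rightarrow> 'a word set \<Rightarrow> 'a word set monoid"
  where "presented_group A R = free_group A Mod relator_subgroup A R"

definition word_image :: "'a set \<Rightarrow> 'a word set \<Rightarrow> 'a word \<Rightarrow> 'a word set"
  where "word_image A R w = relator_subgroup A R #>\<^bsub>free_group A\<^esub> reduce w"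

lemma normal_closure_normal:
  assumes "group G" "S \<subseteq> carrier G"
  shows "normal_closure G S \<lhd> G"
proof -
  interpret group G by fact
  have "carrier G \<lhd> G"
    by (rule normal_invI) (auto simp: subgroup_self)
  then have ne: "{N. N \<lhd> G \<and> S \<subseteq> N} \<noteq> {}"
    using assms(2) by blast
  have "subgroup (normal_closure G S) G"
    unfolding normal_closure_def using ne
    by (intro subgroups_Inter) (auto simp: normal_imp_subgroup)
  then show ?thesis
    by (auto simp: normal_inv_iff normal_closure_def)
qed

lemma relator_subgroup_normal: "R \<subseteq> words A \<Longrightarrow> relator_subgroup A R \<lhd> free_group A"
  unfolding relator_subgroup_def
  by (rule normal_closure_normal) (auto simp: group_free_group reduce_in_free_group)

lemma group_presented_group: "R \<subseteq> words A \<Longrightarrow> group (presented_group A R)"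
  by (simp add: presented_group_def normal.factorgroup_is_group relator_subgroup_normal)

lemma word_image_in_carrier: "w \<in> words A \<Longrightarrow> word_image A R w \<in> carrier (presented_group A R)"
  by (auto simp: word_image_def presented_group_def FactGroup_def RCOSETS_def reduce_in_free_group)


section \<open>Profinite completion\<close>

definition fin_index_normal :: "('a, 'b) monoid_scheme \<Rightarrow> 'a set set"
  where "fin_index_normal G = {N. N \<lhd> G \<and> finite (carrier (G Mod N))}"

text \<open>
  For \<open>N \<subseteq> M\<close>, the canonical map \<open>G / N \<rightarrow> G / M\<close> sends a coset \<open>C\<close> to \<open>M C\<close>.
\<close>

definition profinite_completion :: "('a, 'b) monoid_scheme \<Rightarrow> ('a set \<Rightarrow> 'a set) monoid"
  where "profinite_completion G =
    (product_group (fin_index_normal G) (\<lambda>N. G Mod N))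
      \<lparr>carrier := {f \<in> carrier (product_group (fin_index_normal G) (\<lambda>N. G Mod N)).
         \<forall>N\<in>fin_index_normal G. \<forall>M\<in>fin_index_normal G. N \<subseteq> M \<longrightarrow> M <#>\<^bsub>G\<^esub> f N = f M}\<rparr>"

definition to_profinite :: "('a, 'b) monoid_scheme \<Rightarrow> 'a \<Rightarrow> ('a set \<Rightarrow> 'a set)"
  where "to_profinite G g = (\<lambda>N\<in>fin_index_normal G. N #>\<^bsub>G\<^esub> g)"

lemma quotient_map:
  assumes "N \<lhd> G" "M \<lhd> G" "N \<subseteq> M" "g \<in> carrier G"
  shows "M <#>\<^bsub>G\<^esub> (N #>\<^bsub>G\<^esub> g) = M #>\<^bsub>G\<^esub> g"
proof -
  interpret N: normal N G by fact
  interpret M: normal M G by fact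
  have "M <#>\<^bsub>G\<^esub> N = M"
  proof
    show "M <#>\<^bsub>G\<^esub> N \<subseteq> M"
      using assms(3) M.m_closed by (auto simp: set_mult_def)
    show "M \<subseteq> M <#>\<^bsub>G\<^esub> N"
    proof
      fix m assume m: "m \<in> M"
      have "m \<otimes>\<^bsub>G\<^esub> \<one>\<^bsub>G\<^esub> \<in> M <#>\<^bsub>G\<^esub> N"
        unfolding set_mult_def
        using m subgroup.one_closed[OF N.subgroup_axioms] by blast
      then show "m \<in> M <#>\<^bsub>G\<^esub> N"
        using m M.subset by auto
    qed
  qed
  then show ?thesis
    using assms(4) N.subset M.subset by (simp add: N.setmult_rcos_assoc)
qed

lemma quotient_map_hom:
  assumes "N \<lhd> G" "M \<lhd> G" "N \<subseteq> M"
  shows "(\<lambda>C. M <#>\<^bsub>G\<^esub> C) \<in> hom (G Mod N) (G Mod M)"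
proof -
  interpret N: normal N G by fact
  interpret M: normal M G by fact
  show ?thesis
    using quotient_map[OF assms]
    by (auto simp: hom_def FactGroup_def RCOSETS_def N.rcos_sum M.rcos_sum)
qed

lemma subgroup_profinite_completion:
  assumes "group G"
  shows "subgroup (carrier (profinite_completion G))
           (product_group (fin_index_normal G) (\<lambda>N. G Mod N))"
proof -
  let ?I = "fin_index_normal G" and ?P = "product_group (fin_index_normal G) (\<lambda>N. G Mod N)"
  have fg: "group (G Mod N)" if "N \<in> ?I" for N
    using that by (simp add: fin_index_normal_def normal.factorgroup_is_group)
  have gh: "group_hom (G Mod N) (G Mod M) (\<lambda>C. M <#>\<^bsub>G\<^esub> C)"
    if "N \<in> ?I" "M \<in> ?I" "N \<subseteq> M" for N M
    using that fg quotient_map_hom[of N G M]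
    by (auto simp: fin_index_normal_def group_hom_def group_hom_axioms_def)
  interpret P: group ?P
    by (simp add: fg)
  show ?thesis
  proof (rule P.subgroupI)
    have "\<one>\<^bsub>?P\<^esub> \<in> carrier (profinite_completion G)"
      using group_hom.hom_one[OF gh] P.one_closed
      by (auto simp: profinite_completion_def)
    then show "carrier (profinite_completion G) \<noteq> {}" by blast
  next
    fix f assume f: "f \<in> carrier (profinite_completion G)"
    then have fP: "f \<in> carrier ?P" by (simp add: profinite_completion_def)
    then have fc: "f N \<in> carrier (G Mod N)" if "N \<in> ?I" for N
      using that by auto
    have iv: "inv\<^bsub>?P\<^esub> f = (\<lambda>N\<in>?I. inv\<^bsub>G Mod N\<^esub> f N)"
      using fP by (simp add: fg)
    have "M <#>\<^bsub>G\<^esub> (inv\<^bsub>?P\<^esub> f) N = (inv\<^bsub>?P\<^esub> f) M" if NM: "N \<in> ?I" "M \<in> ?I" "N \<subseteq> M" for N M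
      using group_hom.hom_inv[OF gh[OF NM] fc[OF NM(1)]] f NM
      by (simp add: iv profinite_completion_def)
    then show "inv\<^bsub>?P\<^esub> f \<in> carrier (profinite_completion G)"
      using P.inv_closed[OF fP] by (simp add: profinite_completion_def)
  next
    fix f h assume f: "f \<in> carrier (profinite_completion G)"
      and h: "h \<in> carrier (profinite_completion G)"
    then have fP: "f \<in> carrier ?P" and hP: "h \<in> carrier ?P"
      by (simp_all add: profinite_completion_def)
    then have fc: "f N \<in> carrier (G Mod N)" "h N \<in> carrier (G Mod N)" if "N \<in> ?I" for N
      using that by auto
    have "M <#>\<^bsub>G\<^esub> (f \<otimes>\<^bsub>?P\<^esub> h) N = (f \<otimes>\<^bsub>?P\<^esub> h) M"
      if NM: "N \<in> ?I" "M \<in> ?I" "N \<subseteq> M" for N M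
      using group_hom.hom_mult[OF gh[OF NM] fc[OF NM(1)]] f h NM
      by (simp add: profinite_completion_def)
    then show "f \<otimes>\<^bsub>?P\<^esub> h \<in> carrier (profinite_completion G)"
      using P.m_closed[OF fP hP] by (simp add: profinite_completion_def)
  qed (auto simp: profinite_completion_def)
qed

lemma group_profinite_completion:
  assumes "group G"
  shows "group (profinite_completion G)"
proof -
  have "group (product_group (fin_index_normal G) (\<lambda>N. G Mod N))"
    by (intro product_group) (simp add: fin_index_normal_def normal.factorgroup_is_group)
  from subgroup.subgroup_is_group[OF subgroup_profinite_completion[OF assms] this]
  show ?thesis by (simp add: profinite_completion_def)
qed

lemma to_profinite_hom:
  assumes "group G"
  shows "to_profinite G \<in> hom G (profinite_completion G)"
proof -
  interpret group G by fact
  have "to_profinite G g \<in> carrier (profinite_completion G)" if "g \<in> carrier G" for g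
    using that quotient_map[of _ G _ g]
    by (auto simp: to_profinite_def profinite_completion_def fin_index_normal_def
        FactGroup_def RCOSETS_def)
  moreover have "to_profinite G (g \<otimes>\<^bsub>G\<^esub> h)
      = to_profinite G g \<otimes>\<^bsub>profinite_completion G\<^esub> to_profinite G h"
    if "g \<in> carrier G" "h \<in> carrier G" for g h
    using that
    by (auto simp: to_profinite_def profinite_completion_def fin_index_normal_def
        normal.rcos_sum intro!: restrict_ext)
  ultimately show ?thesis by (simp add: hom_def)
qed


section \<open>Partial recursive functions\<close>

datatype recf = Zero | Succ | Proj nat | Comp recf "recf list" | PrimRec recf recf | Mu recf

text \<open>
  \<open>computes p xs y\<close>: on input \<open>xs\<close> the program \<open>p\<close> halts with output \<open>y\<close>.  The recursion
  variable of \<open>PrimRec\<close> and the search variable of \<open>Mu\<close> come first.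
\<close>

inductive computes :: "recf \<Rightarrow> nat list \<Rightarrow> nat \<Rightarrow> bool" where
  Zero: "computes Zero xs 0"
| Succ: "computes Succ [x] (Suc x)"
| Proj: "i < length xs \<Longrightarrow> computes (Proj i) xs (xs ! i)"
| Comp: "list_all2 (\<lambda>g y. computes g xs y) gs ys \<Longrightarrow> computes f ys z
    \<Longrightarrow> computes (Comp f gs) xs z"
| PrimRec_0: "computes f xs y \<Longrightarrow> computes (PrimRec f g) (0 # xs) y"
| PrimRec_Suc: "computes (PrimRec f g) (n # xs) y \<Longrightarrow> computes g (n # y # xs) z
    \<Longrightarrow> computes (PrimRec f g) (Suc n # xs) z"
| Mu: "computes f (n # xs) 0 \<Longrightarrow> (\<And>m. m < n \<Longrightarrow> \<exists>k. computes f (m # xs) (Suc k))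
    \<Longrightarrow> computes (Mu f) xs n"

inductive_cases computes_ZeroE: "computes Zero xs y"
inductive_cases computes_SuccE: "computes Succ xs y"
inductive_cases computes_ProjE: "computes (Proj i) xs y"
inductive_cases computes_CompE: "computes (Comp f gs) xs y"
inductive_cases computes_PrimRec_0E: "computes (PrimRec f g) (0 # xs) y"
inductive_cases computes_PrimRec_SucE: "computes (PrimRec f g) (Suc n # xs) y"
inductive_cases computes_MuE: "computes (Mu f) xs y"

lemma computes_functional: "computes p xs y \<Longrightarrow> computes p xs z \<Longrightarrow> y = z"
proof (induction p xs y arbitrary: z rule: computes.induct)
  case (Zero xs)
  then show ?case by (auto elim: computes_ZeroE)
next
  case (Succ x)
  then show ?case by (auto elim: computes_SuccE)
next
  case (Proj i xs)
  then show ?case by (auto elim: computes_ProjE)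
next
  case (Comp xs gs ys f y)
  from Comp.prems obtain ys' where
    ys': "list_all2 (\<lambda>g y. computes g xs y) gs ys'" "computes f ys' z"
    by (auto elim: computes_CompE)
  have "ys = ys'"
    using Comp.IH(1) ys'(1) by (auto simp: list_all2_conv_all_nth intro!: nth_equalityI)
  then show ?case using Comp.IH(2) ys'(2) by blast
next
  case (PrimRec_0 f xs y g)
  then show ?case by (blast elim: computes_PrimRec_0E)
next
  case (PrimRec_Suc f g n xs y z')
  then show ?case by (blast elim: computes_PrimRec_SucE)
next
  case (Mu f n xs)
  from Mu.prems have z: "computes f (z # xs) 0" "\<And>m. m < z \<Longrightarrow> \<exists>k. computes f (m # xs) (Suc k)"
    by (auto elim: computes_MuE)
  have "\<not> z < n" using Mu.IH(2) z(1) by force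
  moreover have "\<not> n < z" using Mu.IH(1) z(2) by force
  ultimately show ?case by simp
qed


section \<open>Encodings\<close>

definition encode_letter :: "nat letter \<Rightarrow> nat"
  where "encode_letter x = prod_encode (fst x, of_bool (snd x))"

definition encode_word :: "nat word \<Rightarrow> nat"
  where "encode_word w = list_encode (map encode_letter w)"

text \<open>
  A finite presentation is a list of generators, taken from a fixed countable alphabet, and a
  list of relators.
\<close>

type_synonym presentation = "nat list \<times> nat word list"

definition finite_presentation :: "presentation \<Rightarrow> bool"
  where "finite_presentation P \<longleftrightarrow> set (snd P) \<subseteq> words (set (fst P))"

definition group_of :: "presentation \<Rightarrow> nat word set monoid"
  where "group_of P = presented_group (set (fst P)) (set (snd P))"

definition element_of :: "presentation \<Rightarrow> nat word \<Rightarrow> nat word set"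
  where "element_of P w = word_image (set (fst P)) (set (snd P)) w"

definition encode_presentation :: "presentation \<Rightarrow> nat"
  where "encode_presentation P =
    prod_encode (list_encode (fst P), list_encode (map encode_word (snd P)))"

end

theory Submission
  imports Defs "HOL-Algebra.Multiplicative_Group" "HOL-Algebra.Bij"
    "HOL-Library.Product_Plus" "HOL-Library.Function_Algebras" "HOL-Library.Z2"
begin

text \<open>
  Both sides of the equivalence only concern homomorphisms to finite groups, so it suffices to find
  \<open>G\<^sub>w\<close> such that every homomorphism from \<open>G\<^sub>w\<close> to a finite group restricts to one from \<open>G\<close> that
  must be trivial everywhere once it kills \<open>w\<close>, while a finite quotient of \<open>G\<close> in which \<open>w\<close>
  survives yields a nontrivial finite quotient of \<open>G\<^sub>w\<close>.

  To the generators and relators of \<open>G\<close> add a letter \<open>b\<close>, put \<open>\<Lambda> = [w, b]\<close>, and for each letter \<open>a\<close>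
  (including \<open>b\<close>) add letters \<open>X\<^sub>1, Y\<^sub>1, X\<^sub>2, Y\<^sub>2\<close> and the relation \<open>a = [X\<^sub>1, Y\<^sub>1] [X\<^sub>2, Y\<^sub>2]\<close>. Each
  \<open>X \<in> {X\<^sub>i, Y\<^sub>i}\<close> is subject to a relation \<open>\<Lambda> X \<Lambda>\<inverse> X\<inverse> \<Lambda>\<inverse> X \<Lambda> = 1\<close>, which reads \<open>X = 1\<close> when
  \<open>\<Lambda> = 1\<close>. So \<open>w = 1\<close> forces all letters to be trivial.

  Conversely let \<open>w \<noteq> 1\<close> in a finite group \<open>K\<close>, and let \<open>V\<close> be the space of functions from \<open>K\<close> to the
  field with four elements. A letter \<open>a\<close> acts on \<open>V \<times> V\<close> by translation on the first factor, and \<open>b\<close>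
  by multiplication with \<open>\<omega>\<close> to the power \<open>c\<close>, where \<open>c\<close> is a proper 3-colouring of the orbits of \<open>w\<close>.
  Then \<open>\<Lambda>\<close> acts by some \<open>\<lambda>\<close> with \<open>\<lambda>\<^sup>2 + \<lambda> + 1 = 0\<close>, so the elementary matrices satisfy the
  relation imposed on the letters \<open>X\<close>. Every translation, and likewise \<open>b\<close>, is a product of two
  involutions \<open>s\<close>; in characteristic 2 such an \<open>s\<close> has the form \<open>1 + u v\<close> with \<open>v u = 0\<close>, and then
  \<open>diag(s, 1)\<close> is the commutator of the elementary matrices of \<open>u\<close> and \<open>v\<close>.
\<close>

section \<open>Recursive functions\<close>

text \<open>Only lists of length \<open>n\<close> matter, so expressions such as
  \<open>xs ! i\<close> can be composed freely as functions on lists, whatever they yield on other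
  lengths.\<close>

definition recursive :: "nat \<Rightarrow> (nat list \<Rightarrow> nat) \<Rightarrow> bool"
  where "recursive n F \<longleftrightarrow> (\<exists>p. \<forall>xs. length xs = n \<longrightarrow> computes p xs (F xs))"

lemma recursive_nth: "i < n \<Longrightarrow> recursive n (\<lambda>xs. xs ! i)"
  unfolding recursive_def by (intro exI[of _ "Proj i"]) (auto intro: computes.Proj)

lemma recursive_nth_drop:
  assumes "m + i < n"
  shows "recursive n (\<lambda>xs. drop m xs ! i)"
proof -
  have "recursive n (\<lambda>xs. xs ! (m + i))" using assms by (rule recursive_nth)
  moreover have "drop m xs ! i = xs ! (m + i)" if "length xs = n" for xs :: "nat list"
    using that assms by simp
  ultimately show ?thesis by (simp add: recursive_def)
qed

lemma recursive_comp:
  assumes F: "recursive (length Gs) F" and Gs: "\<And>G. G \<in> set Gs \<Longrightarrow> recursive n G"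
  shows "recursive n (\<lambda>xs. F (map (\<lambda>G. G xs) Gs))"
proof -
  obtain p where p: "computes p ys (F ys)" if "length ys = length Gs" for ys
    using F by (auto simp: recursive_def)
  from Gs obtain q where q: "computes (q G) xs (G xs)" if "G \<in> set Gs" "length xs = n" for G xs
    unfolding recursive_def by metis
  have "computes (Comp p (map q Gs)) xs (F (map (\<lambda>G. G xs) Gs))" if "length xs = n" for xs
    by (rule computes.Comp[OF _ p]) (auto simp: list_all2_conv_all_nth q that)
  then show ?thesis by (auto simp: recursive_def)
qed

lemma recursive_comp1:
  assumes "recursive 1 (\<lambda>xs. f (xs ! 0))" "recursive n F"
  shows "recursive n (\<lambda>xs. f (F xs))"
  using recursive_comp[of "[F]" "\<lambda>xs. f (xs ! 0)" n] assms by simp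

lemma recursive_comp2:
  assumes "recursive 2 (\<lambda>xs. f (xs ! 0) (xs ! 1))" "recursive n F" "recursive n G"
  shows "recursive n (\<lambda>xs. f (F xs) (G xs))"
  using recursive_comp[of "[F, G]" "\<lambda>xs. f (xs ! 0) (xs ! 1)" n] assms
  by (auto simp: numeral_2_eq_2)

lemma recursive_Suc:
  assumes "recursive n F"
  shows "recursive n (\<lambda>xs. Suc (F xs))"
proof -
  have "computes Succ xs (Suc (xs ! 0))" if "length xs = 1" for xs
    using that computes.Succ[of "xs ! 0"] by (cases xs) auto
  then have "recursive 1 (\<lambda>xs. Suc (xs ! 0))"
    by (auto simp: recursive_def)
  then show ?thesis using assms by (rule recursive_comp1)
qed

lemma recursive_const: "recursive n (\<lambda>_. c)"
proof (induction c)
  case 0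
  show ?case unfolding recursive_def by (blast intro: computes.Zero)
qed (rule recursive_Suc)

lemma recursive_rec_nat:
  assumes F: "recursive n F" and G: "recursive (Suc (Suc n)) (\<lambda>ys. G (ys ! 0) (ys ! 1) (drop 2 ys))"
    and N: "recursive n N"
  shows "recursive n (\<lambda>xs. rec_nat (F xs) (\<lambda>k y. G k y xs) (N xs))"
proof -
  obtain p where p: "computes p xs (F xs)" if "length xs = n" for xs
    using F by (auto simp: recursive_def)
  obtain q where q: "computes q ys (G (ys ! 0) (ys ! 1) (drop 2 ys))" if "length ys = Suc (Suc n)" for ys
    using G by (auto simp: recursive_def)
  have "computes (PrimRec p q) (m # xs) (rec_nat (F xs) (\<lambda>k y. G k y xs) m)" if "length xs = n" for m xs
  proof (induction m)
    case 0
    then show ?case using p[OF that] by (simp add: computes.PrimRec_0)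
  next
    case (Suc m)
    then show ?case
      using q[of "m # rec_nat (F xs) (\<lambda>k y. G k y xs) m # xs"] that
      by (auto intro: computes.PrimRec_Suc)
  qed
  then have "computes (PrimRec p q) ys (rec_nat (F (tl ys)) (\<lambda>k y. G k y (tl ys)) (hd ys))"
    if "length ys = Suc n" for ys
    using that by (cases ys) auto
  then have "recursive (Suc n) (\<lambda>ys. rec_nat (F (tl ys)) (\<lambda>k y. G k y (tl ys)) (hd ys))"
    by (auto simp: recursive_def)
  \<comment> \<open>The recursion variable must be the head of the argument list, so the program is
    composed with \<open>N\<close> followed by all \<open>n\<close> projections, which rebuild
    \<open>xs\<close>.\<close>
  then have "recursive n (\<lambda>xs. rec_nat (F (tl (map (\<lambda>G. G xs) (N # map (\<lambda>i xs. xs ! i) [0..<n]))))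
     (\<lambda>k y. G k y (tl (map (\<lambda>G. G xs) (N # map (\<lambda>i xs. xs ! i) [0..<n]))))
     (hd (map (\<lambda>G. G xs) (N # map (\<lambda>i xs. xs ! i) [0..<n]))))"
    by (intro recursive_comp) (auto intro: N recursive_nth)
  moreover have "map (\<lambda>i. xs ! i) [0..<n] = xs" if "length xs = n" for xs :: "nat list"
    using that map_nth by blast
  ultimately show ?thesis by (simp add: recursive_def comp_def)
qed

lemma recursive_Least:
  assumes F: "recursive (Suc n) (\<lambda>ys. F (ys ! 0) (drop 1 ys))" and ex: "\<And>xs. \<exists>k. F k xs = 0"
  shows "recursive n (\<lambda>xs. LEAST k. F k xs = 0)"
proof -
  obtain p where p: "computes p ys (F (ys ! 0) (drop 1 ys))" if "length ys = Suc n" for ys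
    using F by (auto simp: recursive_def)
  have "computes (Mu p) xs (LEAST k. F k xs = 0)" if "length xs = n" for xs
  proof (rule computes.Mu)
    show "computes p ((LEAST k. F k xs = 0) # xs) 0"
      using p[of "(LEAST k. F k xs = 0) # xs"] that LeastI_ex[OF ex[of xs]] by simp
    fix m assume "m < (LEAST k. F k xs = 0)"
    then have "F m xs \<noteq> 0" by (rule not_less_Least)
    then show "\<exists>k. computes p (m # xs) (Suc k)"
      using p[of "m # xs"] that by (cases "F m xs") auto
  qed
  then show ?thesis by (auto simp: recursive_def)
qed

named_theorems recursive_intros
declare recursive_nth[recursive_intros] recursive_nth_drop[recursive_intros]
  recursive_Suc[recursive_intros] recursive_const[recursive_intros]

lemma recursive_add [recursive_intros]:
  assumes "recursive n F" "recursive n G"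
  shows "recursive n (\<lambda>xs. F xs + G xs)"
proof -
  have "x + y = rec_nat x (\<lambda>_ z. Suc z) y" for x y by (induction y) auto
  moreover have "recursive n (\<lambda>xs. rec_nat (F xs) (\<lambda>_ z. Suc z) (G xs))"
    by (rule recursive_rec_nat) (use assms in \<open>auto intro!: recursive_intros\<close>)
  ultimately show ?thesis by simp
qed

lemma recursive_pred:
  assumes "recursive n F"
  shows "recursive n (\<lambda>xs. F xs - 1)"
proof -
  have "x - 1 = rec_nat 0 (\<lambda>k _. k) x" for x by (cases x) auto
  moreover have "recursive n (\<lambda>xs. rec_nat 0 (\<lambda>k _. k) (F xs))"
    by (rule recursive_rec_nat) (use assms in \<open>auto intro!: recursive_intros\<close>)
  ultimately show ?thesis by simp
qed

lemma recursive_diff [recursive_intros]: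
  assumes "recursive n F" "recursive n G"
  shows "recursive n (\<lambda>xs. F xs - G xs)"
proof -
  have "rec_nat x (\<lambda>_ z. z - 1) y = x - y" for x y by (induction y) auto
  moreover have "recursive n (\<lambda>xs. rec_nat (F xs) (\<lambda>_ z. z - 1) (G xs))"
    by (rule recursive_rec_nat) (intro assms recursive_pred recursive_nth | simp)+
  ultimately show ?thesis by simp
qed

lemma recursive_case_zero [recursive_intros]:
  assumes "recursive n F" "recursive n G" "recursive n H"
  shows "recursive n (\<lambda>xs. if F xs = 0 then G xs else H xs)"
proof -
  \<comment> \<open>A case distinction is a recursion whose step forgets counter and accumulator;
    \<open>H\<close> therefore reads its parameters from position 2 on.\<close>
  have drop: "recursive (Suc (Suc n)) (\<lambda>ys. H (drop 2 ys))"
  proof -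
    have "recursive (Suc (Suc n)) (\<lambda>ys. H (map (\<lambda>G. G ys) (map (\<lambda>i ys. ys ! (i + 2)) [0..<n])))"
      by (rule recursive_comp) (use assms in \<open>auto intro!: recursive_intros\<close>)
    moreover have "map (\<lambda>i. ys ! (i + 2)) [0..<n] = drop 2 ys" if "length ys = Suc (Suc n)" for ys :: "nat list"
      using that by (auto intro!: nth_equalityI)
    ultimately show ?thesis by (simp add: recursive_def comp_def)
  qed
  have "(if x = 0 then y else z) = rec_nat y (\<lambda>_ _. z) x" for x y z :: nat by (cases x) auto
  moreover have "recursive n (\<lambda>xs. rec_nat (G xs) (\<lambda>_ _. H xs) (F xs))"
    by (rule recursive_rec_nat[where G = "\<lambda>_ _. H"]) (use assms drop in auto)
  ultimately show ?thesis by simp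
qed

section \<open>Pairing functions and folds over coded lists\<close>

lemma recursive_triangle [recursive_intros]:
  assumes "recursive n F"
  shows "recursive n (\<lambda>xs. triangle (F xs))"
proof -
  have "triangle x = rec_nat 0 (\<lambda>k y. y + Suc k) x" for x by (induction x) auto
  moreover have "recursive n (\<lambda>xs. rec_nat 0 (\<lambda>k y. y + Suc k) (F xs))"
    by (rule recursive_rec_nat) (use assms in \<open>auto intro!: recursive_intros\<close>)
  ultimately show ?thesis by simp
qed

lemma recursive_prod_encode [recursive_intros]:
  assumes "recursive n F" "recursive n G"
  shows "recursive n (\<lambda>xs. prod_encode (F xs, G xs))"
  unfolding prod_encode_def by (auto intro!: recursive_intros assms)

lemma triangle_mono: "m \<le> n \<Longrightarrow> triangle m \<le> triangle n"
  by (induction n rule: dec_induct) auto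

text \<open>\<open>prod_encode (a, b)\<close> is \<open>triangle (a + b) + a\<close>, so
  \<open>a + b\<close> is the least \<open>k\<close> with \<open>x < triangle (Suc k)\<close>;
  truncated subtraction turns this inequality into an equation with zero, as \<open>Mu\<close>
  requires.\<close>

lemma sum_prod_decode: "fst (prod_decode x) + snd (prod_decode x) = (LEAST k. Suc x - triangle (Suc k) = 0)"
proof -
  obtain a b where x: "x = prod_encode (a, b)" by (metis prod_decode_inverse surj_pair)
  have "(LEAST k. Suc x - triangle (Suc k) = 0) = a + b"
  proof (rule Least_equality)
    fix k assume k: "Suc x - triangle (Suc k) = 0"
    show "a + b \<le> k"
    proof (rule ccontr)
      assume "\<not> a + b \<le> k"
      then have "triangle (Suc k) \<le> triangle (a + b)" by (intro triangle_mono) simp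
      with k show False by (simp add: x prod_encode_def)
    qed
  qed (simp add: x prod_encode_def)
  then show ?thesis by (simp add: x)
qed

lemma recursive_sum_prod_decode:
  "recursive 1 (\<lambda>xs. fst (prod_decode (xs ! 0)) + snd (prod_decode (xs ! 0)))"
  unfolding sum_prod_decode
  by (rule recursive_Least[where F = "\<lambda>k xs. Suc (xs ! 0) - triangle (Suc k)"])
    (auto intro!: recursive_intros intro: le_add2)

lemma recursive_fst_prod_decode [recursive_intros]:
  assumes "recursive n F"
  shows "recursive n (\<lambda>xs. fst (prod_decode (F xs)))"
proof -
  have "x - triangle (fst (prod_decode x) + snd (prod_decode x)) = fst (prod_decode x)" for x
    using prod_decode_inverse[of x] by (cases "prod_decode x") (auto simp: prod_encode_def)
  then show ?thesis
    using recursive_diff[OF assms recursive_triangle[OF recursive_comp1[OF recursive_sum_prod_decode assms]]]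
    by simp
qed

lemma recursive_snd_prod_decode [recursive_intros]:
  assumes "recursive n F"
  shows "recursive n (\<lambda>xs. snd (prod_decode (F xs)))"
  using recursive_diff[OF recursive_comp1[OF recursive_sum_prod_decode assms]
      recursive_fst_prod_decode[OF assms]]
  by simp

text \<open>The state pairs the code of the unread list with the accumulator. A nonempty list has
  code \<open>Suc (prod_encode (x, c))\<close>, so the predecessor decodes to head and tail; code 0
  is the empty list, where the state stays fixed.\<close>

definition fold_step :: "(nat \<Rightarrow> nat \<Rightarrow> nat) \<Rightarrow> nat \<Rightarrow> nat"
  where "fold_step g s =
    (if fst (prod_decode s) = 0 then s
     else prod_encode (snd (prod_decode (fst (prod_decode s) - 1)),
       g (fst (prod_decode (fst (prod_decode s) - 1))) (snd (prod_decode s))))"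

lemma funpow_fold_step:
  "length xs \<le> n \<Longrightarrow> (fold_step g ^^ n) (prod_encode (list_encode xs, a)) = prod_encode (0, fold g xs a)"
proof (induction n arbitrary: xs a)
  case (Suc n)
  show ?case
  proof (cases xs)
    case Nil
    then show ?thesis using Suc.IH[of "[]" a] by (simp add: fold_step_def)
  next
    case (Cons y ys)
    then have "fold_step g (prod_encode (list_encode xs, a)) = prod_encode (list_encode ys, g y a)"
      by (simp add: fold_step_def)
    then show ?thesis using Suc.IH[of ys "g y a"] Suc.prems Cons by (simp add: funpow_swap1)
  qed
qed simp

text \<open>Supplies an iteration count for \<open>fold_step\<close> that can be read off the code;
  surplus iterations do not change the state.\<close>

lemma length_le_list_encode: "length xs \<le> list_encode xs"
proof (induction xs)
  case (Cons x xs)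
  then show ?case using le_prod_encode_2[of "list_encode xs" x] by simp
qed simp

lemma recursive_fold:
  assumes g: "recursive 2 (\<lambda>ys. g (ys ! 0) (ys ! 1))" and F: "recursive n F" and A: "recursive n A"
  shows "recursive n (\<lambda>xs. fold g (list_decode (F xs)) (A xs))"
proof -
  have "rec_nat s (\<lambda>_. fold_step g) k = (fold_step g ^^ k) s" for s k
    by (induction k) auto
  then have fold: "fold g (list_decode x) a
      = snd (prod_decode (rec_nat (prod_encode (x, a)) (\<lambda>_. fold_step g) x))" for x a
    using funpow_fold_step[OF length_le_list_encode, of "list_decode x" g a] by simp
  show ?thesis
    unfolding fold fold_step_def
    by (intro recursive_snd_prod_decode recursive_rec_nat)
      (auto intro!: recursive_intros recursive_comp2[OF g] assms)
qed

section \<open>Words evaluated in finite groups\<close>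

definition letter_eval :: "('k, 'm) monoid_scheme \<Rightarrow> ('a \<Rightarrow> 'k) \<Rightarrow> 'a letter \<Rightarrow> 'k"
  where "letter_eval K f x = (if snd x then f (fst x) else inv\<^bsub>K\<^esub> f (fst x))"

definition word_eval :: "('k, 'm) monoid_scheme \<Rightarrow> ('a \<Rightarrow> 'k) \<Rightarrow> 'a word \<Rightarrow> 'k"
  where "word_eval K f w = foldr (\<lambda>x y. letter_eval K f x \<otimes>\<^bsub>K\<^esub> y) w \<one>\<^bsub>K\<^esub>"

lemma words_Nil [simp]: "[] \<in> words A"
  and words_Cons [simp]: "x # w \<in> words A \<longleftrightarrow> fst x \<in> A \<and> w \<in> words A"
  and words_append [simp]: "u @ v \<in> words A \<longleftrightarrow> u \<in> words A \<and> v \<in> words A"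
  by (auto simp: words_def mem_Times_iff)

lemma word_eval_Nil [simp]: "word_eval K f [] = \<one>\<^bsub>K\<^esub>"
  and word_eval_Cons: "word_eval K f (x # w) = letter_eval K f x \<otimes>\<^bsub>K\<^esub> word_eval K f w"
  by (simp_all add: word_eval_def)

lemma word_eval_map: "word_eval K f (map (map_prod g id) w) = word_eval K (f \<circ> g) w"
  by (induction w) (simp_all add: word_eval_Cons letter_eval_def)

context group
begin

lemma letter_eval_closed: "f \<in> A \<rightarrow> carrier G \<Longrightarrow> fst x \<in> A \<Longrightarrow> letter_eval G f x \<in> carrier G"
  by (auto simp: letter_eval_def)

lemma word_eval_closed: "f \<in> A \<rightarrow> carrier G \<Longrightarrow> w \<in> words A \<Longrightarrow> word_eval G f w \<in> carrier G"
  by (induction w) (auto simp: word_eval_Cons letter_eval_closed)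

lemma word_eval_append:
  assumes "f \<in> A \<rightarrow> carrier G" "u \<in> words A" "v \<in> words A"
  shows "word_eval G f (u @ v) = word_eval G f u \<otimes> word_eval G f v"
  using assms(2)
  by (induction u)
    (use assms in \<open>auto simp: word_eval_Cons m_assoc letter_eval_closed word_eval_closed\<close>)

lemma letter_eval_inv_letter:
  "f \<in> A \<rightarrow> carrier G \<Longrightarrow> fst x \<in> A \<Longrightarrow> letter_eval G f (inv_letter x) = inv (letter_eval G f x)"
  by (auto simp: letter_eval_def inv_letter_def Pi_iff)

lemma word_eval_cons_reduce:
  assumes f: "f \<in> A \<rightarrow> carrier G" and "fst x \<in> A" "w \<in> words A"
  shows "word_eval G f (cons_reduce x w) = letter_eval G f x \<otimes> word_eval G f w"
proof (cases w)
  case (Cons y ys)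
  then show ?thesis
    using assms
    by (auto simp: word_eval_Cons letter_eval_inv_letter[OF f]
        letter_eval_closed[OF f] word_eval_closed[OF f] simp flip: m_assoc)
qed (simp add: word_eval_Cons)

lemma word_eval_reduce:
  assumes f: "f \<in> A \<rightarrow> carrier G" and "w \<in> words A"
  shows "word_eval G f (reduce w) = word_eval G f w"
  using assms(2)
proof (induction w)
  case (Cons x w)
  then show ?case
    using reduce_in_words[of w A] by (auto simp: reduce_Cons word_eval_Cons word_eval_cons_reduce[OF f])
qed simp

lemma word_eval_hom:
  assumes "f \<in> A \<rightarrow> carrier G"
  shows "word_eval G f \<in> hom (free_group A) G"
  by (rule homI)
    (auto simp: free_group_def word_eval_reduce[OF assms] word_eval_append[OF assms]
      word_eval_closed[OF assms])

text \<open>Freeness in the form needed later: quotient maps of the free group become evaluations of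
  words at the images of the generators.\<close>

lemma hom_free_group_eq:
  assumes h: "h \<in> hom (free_group A) G" and w: "w \<in> words A"
  shows "h (reduce w) = word_eval G (\<lambda>a. h [(a, True)]) w"
proof -
  interpret h: group_hom "free_group A" G h
    by (simp add: group_hom_def group_hom_axioms_def group_free_group h is_group)
  have letter: "h [x] = letter_eval G (\<lambda>a. h [(a, True)]) x" if "fst x \<in> A" for x
  proof (cases "snd x")
    case True
    then have "x = (fst x, True)" by (simp add: prod_eq_iff)
    then show ?thesis using True by (metis letter_eval_def)
  next
    case False
    let ?y = "(fst x, True)"
    have xy: "[x] \<in> carrier (free_group A)" "[?y] \<in> carrier (free_group A)"
      using that by (auto simp: free_group_def reduced_def)
    have "inv_letter x = ?y" using False by (simp add: inv_letter_def)
    then have "[x] \<otimes>\<^bsub>free_group A\<^esub> [?y] = \<one>\<^bsub>free_group A\<^esub>"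
      by (simp add: free_group_def reduce_Cons)
    then have "h [x] \<otimes> h [?y] = \<one>"
      using xy by (metis h.hom_mult h.hom_one)
    then show ?thesis
      using False xy by (simp add: letter_eval_def inv_equality)
  qed
  show ?thesis using w
  proof (induction w)
    case Nil
    then show ?case using h.hom_one by (simp add: free_group_def)
  next
    case (Cons x w)
    have "[x] \<in> carrier (free_group A)"
      using Cons.prems by (auto simp: free_group_def reduced_def)
    moreover have "reduce (x # w) = [x] \<otimes>\<^bsub>free_group A\<^esub> reduce w"
      by (simp add: free_group_def reduce_Cons reduce_reduced[OF reduced_reduce])
    ultimately show ?case
      using Cons reduce_in_free_group[of w A] by (simp add: word_eval_Cons letter)
  qed
qed

end

section \<open>Finite images of a presented group and its profinite completion\<close>

lemma word_eval_eq_one_if_to_profinite_eq_one: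
  assumes R: "R \<subseteq> words A" and w: "w \<in> words A"
    and triv: "to_profinite (presented_group A R) (word_image A R w)
      = \<one>\<^bsub>profinite_completion (presented_group A R)\<^esub>"
    and K: "group K" "finite (carrier K)"
    and f: "f \<in> A \<rightarrow> carrier K" and rel: "\<And>r. r \<in> R \<Longrightarrow> word_eval K f r = \<one>\<^bsub>K\<^esub>"
  shows "word_eval K f w = \<one>\<^bsub>K\<^esub>"
proof -
  let ?G = "presented_group A R"
  interpret K: group K by fact
  interpret E: group_hom "free_group A" K "word_eval K f"
    by (simp add: group_hom_def group_hom_axioms_def group_free_group K.word_eval_hom f K)
  \<comment> \<open>The kernel of the evaluation is one of the normal subgroups intersected in the
    normal closure, so the evaluation factors through the presented group.\<close>
  have "relator_subgroup A R \<subseteq> kernel (free_group A) K (word_eval K f)"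
    unfolding relator_subgroup_def normal_closure_def
  proof (rule Inter_lower, rule CollectI, rule conjI[OF E.normal_kernel])
    show "reduce ` R \<subseteq> kernel (free_group A) K (word_eval K f)"
      using R rel by (auto simp: kernel_def reduce_in_free_group K.word_eval_reduce[OF f] subset_iff)
  qed
  then obtain g where g: "g \<in> hom ?G K"
    and gh: "\<And>x. x \<in> carrier (free_group A) \<Longrightarrow> g (relator_subgroup A R #>\<^bsub>free_group A\<^esub> x) = word_eval K f x"
    using E.FactGroup_universal_kernel[OF relator_subgroup_normal[OF R]]
    unfolding presented_group_def by metis
  interpret g: group_hom ?G K g
    by (simp add: group_hom_def group_hom_axioms_def group_presented_group R g K)
  let ?N = "kernel ?G K g"
  \<comment> \<open>The quotient by the kernel injects into \<open>K\<close>, so the kernel is an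
    index of the completion and the coordinate there can be inspected.\<close>
  have "(\<lambda>X. the_elem (g ` X)) ` carrier (?G Mod ?N) \<subseteq> carrier K"
    using g.FactGroup_the_elem_mem by blast
  then have "finite (carrier (?G Mod ?N))"
    using inj_on_finite[OF g.FactGroup_inj_on _ K(2)] by blast
  then have N: "?N \<in> fin_index_normal ?G"
    by (simp add: fin_index_normal_def g.normal_kernel)
  have "?N #>\<^bsub>?G\<^esub> word_image A R w = to_profinite ?G (word_image A R w) ?N"
    using N by (simp add: to_profinite_def)
  also have "\<dots> = ?N"
    using N by (simp add: triv profinite_completion_def)
  finally have "word_image A R w \<in> ?N"
    by (rule g.coset_join1) (simp_all add: word_image_in_carrier w g.subgroup_kernel)
  then have "g (word_image A R w) = \<one>\<^bsub>K\<^esub>" by (simp add: kernel_def)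
  then show ?thesis
    using gh[of "reduce w"] w by (simp add: word_image_def reduce_in_free_group K.word_eval_reduce[OF f])
qed

lemma hom_quotient_presented_group:
  assumes "R \<subseteq> words A" "N \<lhd> presented_group A R"
  shows "(\<lambda>u. N #>\<^bsub>presented_group A R\<^esub> (relator_subgroup A R #>\<^bsub>free_group A\<^esub> u))
    \<in> hom (free_group A) (presented_group A R Mod N)"
proof -
  interpret R: normal "relator_subgroup A R" "free_group A"
    by (rule relator_subgroup_normal) fact
  interpret N: normal N "presented_group A R" by fact
  have "(\<lambda>a. N #>\<^bsub>presented_group A R\<^esub> a) \<circ> (\<lambda>u. relator_subgroup A R #>\<^bsub>free_group A\<^esub> u)
      \<in> hom (free_group A) (presented_group A R Mod N)"
    by (rule hom_compose[OF _ N.r_coset_hom_Mod]) (simp add: presented_group_def R.r_coset_hom_Mod)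
  then show ?thesis by (simp add: comp_def)
qed

lemma word_image_relator:
  assumes "R \<subseteq> words A" "r \<in> R"
  shows "word_image A R r = \<one>\<^bsub>presented_group A R\<^esub>"
proof -
  have "reduce r \<in> relator_subgroup A R"
    using assms by (auto simp: relator_subgroup_def normal_closure_def)
  moreover have "reduce r \<in> carrier (free_group A)"
    using assms by (auto intro: reduce_in_free_group)
  ultimately have "relator_subgroup A R #>\<^bsub>free_group A\<^esub> reduce r = relator_subgroup A R"
    using group.coset_join2[OF group_free_group _ normal_imp_subgroup[OF relator_subgroup_normal[OF assms(1)]]]
    by blast
  then show ?thesis by (simp add: word_image_def presented_group_def)
qed

text \<open>An element of the completion that is not the unit differs from it at some
  \<open>N\<close>; the quotient by this \<open>N\<close> is the required finite group. Its type is
  spelled out because types cannot be quantified existentially.\<close>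

lemma finite_group_if_to_profinite_neq_one:
  fixes A :: "'a set"
  assumes R: "R \<subseteq> words A" and w: "w \<in> words A"
    and nontriv: "to_profinite (presented_group A R) (word_image A R w)
      \<noteq> \<one>\<^bsub>profinite_completion (presented_group A R)\<^esub>"
  shows "\<exists>(K :: 'a word set set monoid) f. group K \<and> finite (carrier K) \<and> f \<in> A \<rightarrow> carrier K
    \<and> (\<forall>r\<in>R. word_eval K f r = \<one>\<^bsub>K\<^esub>) \<and> word_eval K f w \<noteq> \<one>\<^bsub>K\<^esub>"
proof -
  let ?G = "presented_group A R"
  have "\<exists>N\<in>fin_index_normal ?G. N #>\<^bsub>?G\<^esub> word_image A R w \<noteq> N"
  proof (rule ccontr)
    assume "\<not> ?thesis"
    then have "to_profinite ?G (word_image A R w) = \<one>\<^bsub>profinite_completion ?G\<^esub>"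
      by (auto simp: to_profinite_def profinite_completion_def intro!: restrict_ext)
    with nontriv show False by contradiction
  qed
  then obtain N where N: "N \<lhd> ?G" and fin: "finite (carrier (?G Mod N))"
    and Nw: "N #>\<^bsub>?G\<^esub> word_image A R w \<noteq> N"
    by (auto simp: fin_index_normal_def)
  interpret N: normal N ?G by fact
  interpret Q: group "?G Mod N" by (rule N.factorgroup_is_group)
  let ?h = "\<lambda>u. N #>\<^bsub>?G\<^esub> (relator_subgroup A R #>\<^bsub>free_group A\<^esub> u)"
  have h: "?h \<in> hom (free_group A) (?G Mod N)"
    by (rule hom_quotient_presented_group) fact+
  have eval: "word_eval (?G Mod N) (\<lambda>a. ?h [(a, True)]) u = N #>\<^bsub>?G\<^esub> word_image A R u" if "u \<in> words A" for u
    using Q.hom_free_group_eq[OF h that] by (simp add: word_image_def)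
  show ?thesis
  proof (intro exI[of _ "?G Mod N"] exI[of _ "\<lambda>a. ?h [(a, True)]"] conjI ballI)
    show "(\<lambda>a. ?h [(a, True)]) \<in> A \<rightarrow> carrier (?G Mod N)"
      using hom_in_carrier[OF h] by (auto simp: free_group_def reduced_def)
    show "word_eval (?G Mod N) (\<lambda>a. ?h [(a, True)]) r = \<one>\<^bsub>?G Mod N\<^esub>" if "r \<in> R" for r
      using that R eval[of r] word_image_relator[OF R that] N.subset by auto
  qed (use fin Nw eval[OF w] in \<open>auto intro: Q.is_group\<close>)
qed

text \<open>Every finite quotient consists of evaluations of words at the images of the generators,
  so it is trivial; a product of trivial groups has one element.\<close>

lemma trivial_profinite_completion_if_generators_trivial:
  assumes R: "R \<subseteq> words A"
    and gens: "\<And>a. a \<in> A \<Longrightarrow> to_profinite (presented_group A R) (word_image A R [(a, True)])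
      = \<one>\<^bsub>profinite_completion (presented_group A R)\<^esub>"
  shows "trivial_group (profinite_completion (presented_group A R))"
proof -
  let ?G = "presented_group A R"
  have carrier: "carrier (?G Mod N) = {N}" if N: "N \<in> fin_index_normal ?G" for N
  proof -
    from N interpret N: normal N ?G by (simp add: fin_index_normal_def)
    interpret Q: group "?G Mod N" by (rule N.factorgroup_is_group)
    let ?h = "\<lambda>u. N #>\<^bsub>?G\<^esub> (relator_subgroup A R #>\<^bsub>free_group A\<^esub> u)"
    have h: "?h \<in> hom (free_group A) (?G Mod N)"
      by (rule hom_quotient_presented_group[OF R N.normal_axioms])
    have "?h [(a, True)] = N" if "a \<in> A" for a
      using fun_cong[OF gens[OF that], of N] N
      by (simp add: to_profinite_def profinite_completion_def word_image_def reduce_Cons)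
    then have "word_eval (?G Mod N) (\<lambda>a. ?h [(a, True)]) u = N" if "u \<in> words A" for u
      using that
    proof (induction u)
      case (Cons x u)
      then show ?case using Q.inv_one Q.l_one[OF Q.one_closed] by (auto simp: word_eval_Cons letter_eval_def)
    qed simp
    then have "?h u = N" if "u \<in> carrier (free_group A)" for u
      using that Q.hom_free_group_eq[OF h, of u] by (simp add: free_group_def reduce_reduced)
    then have "carrier (?G Mod N) \<subseteq> {N}"
      by (auto simp: carrier_FactGroup presented_group_def)
    then show ?thesis using Q.one_closed by auto
  qed
  have "f = \<one>\<^bsub>profinite_completion ?G\<^esub>" if "f \<in> carrier (profinite_completion ?G)" for f
    using that carrier
    by (auto simp: profinite_completion_def PiE_iff extensional_def fun_eq_iff)
  then show ?thesis
    using group.trivial_group_subset[OF group_profinite_completion[OF group_presented_group[OF R]]] by auto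
qed

section \<open>The encoding\<close>

definition gen :: "nat \<Rightarrow> nat \<Rightarrow> nat"
  where "gen i a = prod_encode (a, i)"

abbreviation pos :: "nat \<Rightarrow> nat letter" where "pos x \<equiv> (x, True)"
abbreviation neg :: "nat \<Rightarrow> nat letter" where "neg x \<equiv> (x, False)"

definition comm_word :: "nat \<Rightarrow> nat \<Rightarrow> nat word"
  where "comm_word x y = [pos x, pos y, neg x, neg y]"

text \<open>Read as \<open>(l x l\<inverse>) x\<inverse> (l\<inverse> x l)\<close>, a product of
  conjugates of \<open>x\<close> and of its inverse. For elementary matrices conjugation scales the
  entry, so the word adds up three multiples of one entry.\<close>

definition kill_word :: "nat \<Rightarrow> nat \<Rightarrow> nat word"
  where "kill_word l x = [pos l, pos x, neg l, neg x, neg l, pos x, pos l]"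

definition letter_gens :: "nat \<Rightarrow> nat list"
  where "letter_gens a = [gen 0 a, gen 1 a, gen 2 a, gen 3 a, gen 4 a]"

definition letter_rels :: "nat \<Rightarrow> nat word list"
  where "letter_rels a =
    [neg (gen 0 a) # comm_word (gen 1 a) (gen 2 a) @ comm_word (gen 3 a) (gen 4 a),
     kill_word (gen 5 0) (gen 1 a), kill_word (gen 5 0) (gen 2 a),
     kill_word (gen 5 0) (gen 3 a), kill_word (gen 5 0) (gen 4 a)]"

definition embed_letter :: "nat letter \<Rightarrow> nat letter"
  where "embed_letter = map_prod (\<lambda>a. gen 0 (Suc a)) id"

text \<open>The letter \<open>gen 0 (Suc a)\<close> stands for the generator \<open>a\<close> of \<open>G\<close>, and \<open>gen 0 0\<close> for \<open>b\<close>; the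
  letters \<open>gen 1 a, \<dots>, gen 4 a\<close> are \<open>X\<^sub>1, Y\<^sub>1, X\<^sub>2, Y\<^sub>2\<close>; finally \<open>gen 5 0\<close> is \<open>\<Lambda>\<close> and \<open>gen 6 0\<close>
  abbreviates \<open>w\<close>, so that the inverse of \<open>w\<close> need not be computed. The order of generators and
  relators is irrelevant, which allows plain accumulating folds.\<close>

definition encoding_gens :: "nat list \<Rightarrow> nat list"
  where "encoding_gens A =
    fold (\<lambda>a xs. letter_gens (Suc a) @ xs) A (letter_gens 0 @ [gen 5 0, gen 6 0])"

definition encoding_rels :: "presentation \<Rightarrow> nat word \<Rightarrow> nat word list"
  where "encoding_rels P w =
    fold (\<lambda>r xs. map embed_letter r # xs) (snd P)
      (fold (\<lambda>a xs. letter_rels (Suc a) @ xs) (fst P)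
        (letter_rels 0 @
          [neg (gen 6 0) # map embed_letter w, neg (gen 5 0) # comm_word (gen 6 0) (gen 0 0)]))"

definition encoding :: "presentation \<Rightarrow> nat word \<Rightarrow> presentation"
  where "encoding P w = (encoding_gens (fst P), encoding_rels P w)"

lemma set_fold_append: "set (fold (\<lambda>a xs. f a @ xs) as ys) = (\<Union>a\<in>set as. set (f a)) \<union> set ys"
  by (induction as arbitrary: ys) auto

lemma set_fold_Cons: "set (fold (\<lambda>a xs. f a # xs) as ys) = f ` set as \<union> set ys"
  by (induction as arbitrary: ys) auto

lemma set_encoding_gens:
  "set (encoding_gens A) = (\<Union>a\<in>insert 0 (Suc ` set A). set (letter_gens a)) \<union> {gen 5 0, gen 6 0}"
  by (auto simp: encoding_gens_def set_fold_append)

lemma set_encoding_rels: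
  "set (encoding_rels P w) = map embed_letter ` set (snd P)
    \<union> (\<Union>a\<in>insert 0 (Suc ` set (fst P)). set (letter_rels a))
    \<union> {neg (gen 6 0) # map embed_letter w, neg (gen 5 0) # comm_word (gen 6 0) (gen 0 0)}"
  by (auto simp: encoding_rels_def set_fold_append set_fold_Cons)

lemma map_embed_letter_in_words:
  "w \<in> words A \<Longrightarrow> map embed_letter w \<in> words (gen 0 ` Suc ` A)"
  by (induction w) (auto simp: embed_letter_def)

lemma words_mono: "w \<in> words A \<Longrightarrow> A \<subseteq> B \<Longrightarrow> w \<in> words B"
  by (induction w) auto

lemma finite_presentation_encoding:
  assumes "finite_presentation P" "w \<in> words (set (fst P))"
  shows "finite_presentation (encoding P w)"
proof -
  let ?A = "set (encoding_gens (fst P))"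
  have "gen 0 ` Suc ` set (fst P) \<subseteq> ?A"
    by (auto simp: set_encoding_gens letter_gens_def)
  then have embed: "map embed_letter u \<in> words ?A" if "u \<in> words (set (fst P))" for u
    using map_embed_letter_in_words[OF that] words_mono by blast
  have letters: "{gen 5 0, gen 6 0} \<subseteq> ?A" "set (letter_gens 0) \<subseteq> ?A"
    "\<And>a. a \<in> set (fst P) \<Longrightarrow> set (letter_gens (Suc a)) \<subseteq> ?A"
    by (auto simp: set_encoding_gens)
  have rels: "set (letter_rels a) \<subseteq> words ?A" if "set (letter_gens a) \<subseteq> ?A" for a
    using that letters(1) by (auto simp: letter_rels_def letter_gens_def comm_word_def kill_word_def)
  have "set (encoding_rels P w) \<subseteq> words ?A"
    unfolding set_encoding_rels
    using assms embed rels letters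
    by (auto simp: finite_presentation_def letter_gens_def comm_word_def dest!: subsetD[OF rels, rotated])
  then show ?thesis by (simp add: finite_presentation_def encoding_def)
qed

section \<open>Computability of the encoding\<close>

lemma recursive_map [recursive_intros]:
  assumes f: "recursive 1 (\<lambda>ys. f (ys ! 0))" and F: "recursive n F"
  shows "recursive n (\<lambda>xs. list_encode (map f (list_decode (F xs))))"
proof -
  let ?cons = "\<lambda>x c. Suc (prod_encode (x, c))"
  \<comment> \<open>Prepending during a fold reverses the list; a second fold that only prepends
    restores the order.\<close>
  have rev: "list_encode (rev (map h xs) @ ys) = fold (\<lambda>x. ?cons (h x)) xs (list_encode ys)"
    for h :: "nat \<Rightarrow> nat" and xs ys
  proof (induction xs arbitrary: ys)
    case (Cons x xs)
    then show ?case using Cons[of "h x # ys"] by simp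
  qed simp
  have map: "list_encode (map f xs)
      = fold ?cons (list_decode (fold (\<lambda>x. ?cons (f x)) xs 0)) 0" for xs
  proof -
    have "fold (\<lambda>x. ?cons (f x)) xs 0 = list_encode (rev (map f xs))"
      using rev[of f xs "[]"] by (simp only: append_Nil2 list_encode.simps)
    then have "list_decode (fold (\<lambda>x. ?cons (f x)) xs 0) = rev (map f xs)"
      by (metis list_encode_inverse)
    moreover have "list_encode (map f xs) = fold ?cons (rev (map f xs)) 0"
      using rev[of "\<lambda>x. x" "rev (map f xs)" "[]"] by (simp only: list.map_ident rev_rev_ident append_Nil2 list_encode.simps)
    ultimately show ?thesis by (simp only:)
  qed
  show ?thesis
    unfolding map
    by (intro recursive_fold F recursive_const)
      (auto intro!: recursive_intros recursive_comp1[OF f])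
qed

lemma list_encode_append:
  "list_encode (xs @ ys) = foldr (\<lambda>x c. Suc (prod_encode (x, c))) xs (list_encode ys)"
  by (induction xs) auto

text \<open>A simulation argument, moving a fold on presentations to a fold on codes one step at a
  time.\<close>

lemma encode_fold:
  assumes "\<And>x s. e (h x s) = g (d x) (e s)"
  shows "e (fold h xs s) = fold g (map d xs) (e s)"
  using assms by (induction xs arbitrary: s) auto

definition embed_letter_code :: "nat \<Rightarrow> nat"
  where "embed_letter_code x =
    prod_encode (prod_encode (Suc (fst (prod_decode x)), 0), snd (prod_decode x))"

definition embed_word_code :: "nat \<Rightarrow> nat"
  where "embed_word_code x = list_encode (map embed_letter_code (list_decode x))"

lemma encode_word_embed: "encode_word (map embed_letter w) = embed_word_code (encode_word w)"
proof -
  have "encode_letter (embed_letter x) = embed_letter_code (encode_letter x)" for x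
    by (simp add: embed_letter_code_def embed_letter_def encode_letter_def gen_def)
  then show ?thesis by (simp add: encode_word_def embed_word_code_def comp_def)
qed

lemma recursive_embed_word_code [recursive_intros]:
  "recursive n F \<Longrightarrow> recursive n (\<lambda>xs. embed_word_code (F xs))"
  unfolding embed_word_code_def embed_letter_code_def
  by (auto intro!: recursive_intros)

text \<open>The number of prepended entries is fixed, so this unfolds to a finite nest of pairings
  in \<open>a\<close> and \<open>c\<close>; the same holds for the relators below.\<close>

definition append_gens_code :: "nat \<Rightarrow> nat \<Rightarrow> nat"
  where "append_gens_code a c = foldr (\<lambda>x c. Suc (prod_encode (x, c))) (letter_gens a) c"

definition append_rels_code :: "nat \<Rightarrow> nat \<Rightarrow> nat"
  where "append_rels_code a c =
    foldr (\<lambda>x c. Suc (prod_encode (x, c))) (map encode_word (letter_rels a)) c"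

lemmas code_simps = letter_gens_def letter_rels_def comm_word_def kill_word_def
  encode_word_def encode_letter_def gen_def

lemma recursive_append_gens_code [recursive_intros]:
  "recursive n F \<Longrightarrow> recursive n G \<Longrightarrow> recursive n (\<lambda>xs. append_gens_code (F xs) (G xs))"
  unfolding append_gens_code_def code_simps list.simps foldr.simps comp_def id_def
  by (intro recursive_intros)

lemma recursive_append_rels_code [recursive_intros]:
  "recursive n F \<Longrightarrow> recursive n G \<Longrightarrow> recursive n (\<lambda>xs. append_rels_code (F xs) (G xs))"
  unfolding append_rels_code_def code_simps list.simps append.simps list_encode.simps foldr.simps
    comp_def id_def fst_conv snd_conv
  by (intro recursive_intros)

text \<open>The right-hand side depends on \<open>P\<close> and \<open>w\<close> only through codes
  available in the input. The round trips through \<open>list_decode\<close> give the folds the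
  shape that \<open>recursive_fold\<close> handles.\<close>

lemma encode_encoding:
  "encode_presentation (encoding P w) = prod_encode
    (fold (\<lambda>a. append_gens_code (Suc a)) (list_decode (list_encode (fst P)))
       (append_gens_code 0 (list_encode [gen 5 0, gen 6 0])),
     fold (\<lambda>r c. Suc (prod_encode (embed_word_code r, c))) (list_decode (list_encode (map encode_word (snd P))))
       (fold (\<lambda>a. append_rels_code (Suc a)) (list_decode (list_encode (fst P)))
         (append_rels_code 0
           (Suc (prod_encode (Suc (prod_encode (encode_letter (neg (gen 6 0)), embed_word_code (encode_word w))),
              list_encode [encode_word (neg (gen 5 0) # comm_word (gen 6 0) (gen 0 0))]))))))"
proof -
  have gens: "list_encode (encoding_gens A) = fold (\<lambda>a. append_gens_code (Suc a)) (map id A)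
      (list_encode (letter_gens 0 @ [gen 5 0, gen 6 0]))" for A
    unfolding encoding_gens_def
    by (rule encode_fold) (simp add: list_encode_append append_gens_code_def)
  have rels: "list_encode (map encode_word (fold (\<lambda>a xs. letter_rels (Suc a) @ xs) A R))
      = fold (\<lambda>a. append_rels_code (Suc a)) (map id A) (list_encode (map encode_word R))" for A R
    by (rule encode_fold) (simp add: list_encode_append append_rels_code_def)
  have embed: "list_encode (map encode_word (fold (\<lambda>r xs. map embed_letter r # xs) S R))
      = fold (\<lambda>r c. Suc (prod_encode (embed_word_code r, c))) (map encode_word S) (list_encode (map encode_word R))"
    for R S
    by (rule encode_fold) (simp add: encode_word_embed)
  have "encode_word (x # u) = Suc (prod_encode (encode_letter x, encode_word u))" for x u
    by (simp add: encode_word_def)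
  then show ?thesis
    by (simp add: encode_presentation_def encoding_def gens encoding_rels_def embed rels list_encode_append
        flip: append_gens_code_def append_rels_code_def encode_word_embed)
qed

lemma encoding_computable:
  "\<exists>p. \<forall>P w. computes p [encode_presentation P, encode_word w] (encode_presentation (encoding P w))"
proof -
  let ?A = "\<lambda>xs. fst (prod_decode (xs ! 0))" and ?R = "\<lambda>xs. snd (prod_decode (xs ! 0))"
  define F where "F xs = prod_encode
    (fold (\<lambda>a. append_gens_code (Suc a)) (list_decode (?A xs))
       (append_gens_code 0 (list_encode [gen 5 0, gen 6 0])),
     fold (\<lambda>r c. Suc (prod_encode (embed_word_code r, c))) (list_decode (?R xs))
       (fold (\<lambda>a. append_rels_code (Suc a)) (list_decode (?A xs))
         (append_rels_code 0
           (Suc (prod_encode (Suc (prod_encode (encode_letter (neg (gen 6 0)), embed_word_code (xs ! 1))),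
              list_encode [encode_word (neg (gen 5 0) # comm_word (gen 6 0) (gen 0 0))]))))))" for xs
  have "recursive 2 F"
    unfolding F_def by (intro recursive_intros recursive_fold) simp_all
  then obtain p where p: "computes p xs (F xs)" if "length xs = 2" for xs
    by (auto simp: recursive_def)
  have "computes p [encode_presentation P, encode_word w] (encode_presentation (encoding P w))" for P w
    using p[of "[encode_presentation P, encode_word w]"]
    by (simp add: F_def encode_encoding encode_presentation_def[of P])
  then show ?thesis by blast
qed

section \<open>Collapse of the encoded group when the word dies\<close>

lemma (in group) generators_trivial_if_word_trivial:
  assumes f: "f \<in> set (fst (encoding P w)) \<rightarrow> carrier G"
    and rel: "\<And>r. r \<in> set (snd (encoding P w)) \<Longrightarrow> word_eval G f r = \<one>"
    and w: "word_eval G (\<lambda>a. f (gen 0 (Suc a))) w = \<one>"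
    and x: "x \<in> set (fst (encoding P w))"
  shows "f x = \<one>"
proof -
  let ?I = "insert 0 (Suc ` set (fst P))"
  have closed: "f (gen 5 0) \<in> carrier G" "f (gen 6 0) \<in> carrier G"
    "\<And>a i. a \<in> ?I \<Longrightarrow> i \<le> 4 \<Longrightarrow> f (gen i a) \<in> carrier G"
  proof -
    fix a i :: nat assume "a \<in> ?I" "i \<le> 4"
    moreover from \<open>i \<le> 4\<close> have "gen i a \<in> set (letter_gens a)"
      by (auto simp: letter_gens_def le_Suc_eq numeral_eq_Suc)
    ultimately show "f (gen i a) \<in> carrier G"
      using f unfolding encoding_def fst_conv set_encoding_gens by blast
  qed (use f in \<open>auto simp: encoding_def set_encoding_gens\<close>)
  have rel': "word_eval G f r = \<one>"
    if "a \<in> ?I \<and> r \<in> set (letter_rels a) \<or> r = neg (gen 6 0) # map embed_letter w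
      \<or> r = neg (gen 5 0) # comm_word (gen 6 0) (gen 0 0)" for a r
    using that by (intro rel) (auto simp: encoding_def set_encoding_rels)
  \<comment> \<open>The relators are used in the order in which triviality spreads:
    \<open>w\<close>, then the commutator \<open>\<Lambda>\<close>, then the letters
    \<open>X\<close> and \<open>Y\<close>, and last the letters expressed by their
    commutators.\<close>
  have "word_eval G f (map embed_letter w) = \<one>"
    using w by (simp add: embed_letter_def word_eval_map comp_def)
  then have 6: "f (gen 6 0) = \<one>"
    using rel'[of 0 "neg (gen 6 0) # map embed_letter w"] closed(2)
    by (simp add: word_eval_Cons letter_eval_def)
  have 5: "f (gen 5 0) = \<one>"
    using rel'[of 0 "neg (gen 5 0) # comm_word (gen 6 0) (gen 0 0)"] closed(1) closed(3)[of 0 0] 6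
    by (simp add: word_eval_Cons letter_eval_def comm_word_def)
  have kill: "f y = \<one>" if "word_eval G f (kill_word (gen 5 0) y) = \<one>" "f y \<in> carrier G" for y
    using that by (simp add: 5 kill_word_def word_eval_Cons letter_eval_def)
  have gens: "f (gen i a) = \<one>" if a: "a \<in> ?I" and i: "i \<in> {1, 2, 3, 4}" for i a
  proof (rule kill)
    show "word_eval G f (kill_word (gen 5 0) (gen i a)) = \<one>"
      using a i by (intro rel'[of a]) (auto simp: letter_rels_def)
    show "f (gen i a) \<in> carrier G" using a i by (intro closed(3)) auto
  qed
  have gen0: "f (gen 0 a) = \<one>" if a: "a \<in> ?I" for a
  proof -
    have "word_eval G f (neg (gen 0 a) # comm_word (gen 1 a) (gen 2 a) @ comm_word (gen 3 a) (gen 4 a)) = \<one>"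
      using a by (intro rel'[of a]) (simp add: letter_rels_def)
    moreover have "f (gen 1 a) = \<one>" "f (gen 2 a) = \<one>" "f (gen 3 a) = \<one>" "f (gen 4 a) = \<one>"
      using a by (auto intro!: gens)
    moreover have "f (gen 0 a) \<in> carrier G" using a by (rule closed(3)) simp
    ultimately show ?thesis by (simp add: word_eval_Cons letter_eval_def comm_word_def)
  qed
  consider a where "a \<in> ?I" "x \<in> set (letter_gens a)" | "x = gen 5 0" | "x = gen 6 0"
    using x unfolding encoding_def fst_conv set_encoding_gens by blast
  then show ?thesis
  proof cases
    case 1
    then have "x = gen 0 a \<or> x = gen 1 a \<or> x = gen 2 a \<or> x = gen 3 a \<or> x = gen 4 a"
      by (simp add: letter_gens_def)
    then show ?thesis using gen0[OF 1(1)] gens[OF 1(1), of 1] gens[OF 1(1), of 2]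
        gens[OF 1(1), of 3] gens[OF 1(1), of 4] by (elim disjE) simp_all
  qed (simp_all only: 5 6)
qed

section \<open>Left multiplications in a finite group\<close>

lemma (in group) mult_inv_cancel:
  assumes "x \<in> carrier G" "y \<in> carrier G"
  shows "x \<otimes> (inv x \<otimes> y) = y" "inv x \<otimes> (x \<otimes> y) = y"
  using assms by (simp_all flip: m_assoc)

lemma (in group) pow_Suc_mult:
  assumes "h \<in> carrier G" "k \<in> carrier G"
  shows "h [^] Suc n \<otimes> k = h \<otimes> (h [^] n \<otimes> k)"
  unfolding nat_pow_Suc2[OF assms(1)] by (rule m_assoc) (use assms in auto)

text \<open>\<open>r\<close> picks a point in every orbit of left multiplication by
  \<open>h\<close>. In a finite group the inverse of \<open>h\<close> is a natural power, so natural
  exponents suffice, which later allows taking a least one.\<close>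

lemma (in group) powers_representative:
  assumes fin: "finite (carrier G)" and h: "h \<in> carrier G"
  shows "\<exists>r. \<forall>k\<in>carrier G.
    r k \<in> carrier G \<and> r (h \<otimes> k) = r k \<and> (\<exists>n::nat. k = h [^] n \<otimes> r k)"
proof -
  define Orb where "Orb k = {r \<in> carrier G. \<exists>n::nat. k = h [^] n \<otimes> r}" for k
  have self: "k \<in> Orb k" if "k \<in> carrier G" for k
    using that by (auto simp: Orb_def intro!: exI[of _ "0::nat"])
  have shift: "Orb (h \<otimes> k) = Orb k" if k: "k \<in> carrier G" for k
  proof (intro Set.equalityI subsetI)
    fix r assume "r \<in> Orb k"
    then obtain n :: nat where r: "r \<in> carrier G" "k = h [^] n \<otimes> r" by (auto simp: Orb_def)
    then have "h \<otimes> k = h [^] Suc n \<otimes> r"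
      using pow_Suc_mult[OF h r(1), of n] by (simp only:)
    with r show "r \<in> Orb (h \<otimes> k)" unfolding Orb_def by blast
  next
    fix r assume "r \<in> Orb (h \<otimes> k)"
    then obtain n :: nat where r: "r \<in> carrier G" "h \<otimes> k = h [^] n \<otimes> r" by (auto simp: Orb_def)
    \<comment> \<open>\<open>h [^] m\<close> is the inverse of \<open>h\<close>; it leads back from
      \<open>h \<otimes> k\<close> to \<open>k\<close>.\<close>
    obtain m where m: "order G = Suc m"
      using fin order_gt_0_iff_finite gr0_implies_Suc by blast
    have "h [^] m \<otimes> h = \<one>" using pow_order_eq_1[OF h] m by simp
    then have "k = h [^] m \<otimes> (h \<otimes> k)" using h k by (simp flip: m_assoc)
    also have "\<dots> = h [^] (m + n) \<otimes> r" using h r by (simp add: r(2) flip: m_assoc nat_pow_mult)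
    finally show "r \<in> Orb k" using r(1) unfolding Orb_def by blast
  qed
  have some: "(SOME r. r \<in> Orb k) \<in> Orb k" if "k \<in> carrier G" for k
    using self[OF that] by (rule someI)
  show ?thesis
  proof (intro exI[of _ "\<lambda>k. SOME r. r \<in> Orb k"] ballI conjI)
    fix k assume k: "k \<in> carrier G"
    show "(SOME r. r \<in> Orb k) \<in> carrier G" "\<exists>n::nat. k = h [^] n \<otimes> (SOME r. r \<in> Orb k)"
      using some[OF k] unfolding Orb_def by simp_all
    show "(SOME r. r \<in> Orb (h \<otimes> k)) = (SOME r. r \<in> Orb k)"
      by (simp only: shift[OF k])
  qed
qed

text \<open>On the coset \<open>\<langle>h\<rangle>r\<close> the two involutions are \<open>h\<^sup>n r \<mapsto> h\<^sup>-\<^sup>n r\<close> and \<open>h\<^sup>n r \<mapsto> h\<^sup>1\<^sup>-\<^sup>n r\<close>.\<close>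

lemma (in group) left_mult_product_of_involutions:
  assumes fin: "finite (carrier G)" and h: "h \<in> carrier G"
  shows "\<exists>x y. x \<in> carrier G \<rightarrow> carrier G \<and> y \<in> carrier G \<rightarrow> carrier G
    \<and> (\<forall>k\<in>carrier G. x (x k) = k \<and> y (y k) = k \<and> y (x k) = h \<otimes> k)"
proof -
  obtain r where r_all: "\<forall>k\<in>carrier G.
      r k \<in> carrier G \<and> r (h \<otimes> k) = r k \<and> (\<exists>n::nat. k = h [^] n \<otimes> r k)"
    using powers_representative[OF assms] by (elim exE)
  have r: "r k \<in> carrier G" if "k \<in> carrier G" for k
    using bspec[OF r_all that] by (rule conjunct1)
  have rh: "r (h \<otimes> k) = r k" if "k \<in> carrier G" for k
    using bspec[OF r_all that] by (elim conjE)
  have rep: "\<exists>n::nat. k = h [^] n \<otimes> r k" if "k \<in> carrier G" for k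
    using bspec[OF r_all that] by (elim conjE)
  have rpow: "r (h [^] n \<otimes> k) = r k" if "k \<in> carrier G" for n :: nat and k
  proof (induction n)
    case (Suc n)
    have "h [^] Suc n \<otimes> k = h \<otimes> (h [^] n \<otimes> k)"
      using h that by (rule pow_Suc_mult)
    moreover have "r (h \<otimes> (h [^] n \<otimes> k)) = r (h [^] n \<otimes> k)"
      by (rule rh) (use h that in simp)
    ultimately show ?case using Suc by (simp only:)
  qed (use that in simp)
  have rr: "r (r k) = r k" if k: "k \<in> carrier G" for k
  proof -
    obtain n :: nat where "k = h [^] n \<otimes> r k" using rep[OF k] by blast
    then have "r k = r (h [^] n \<otimes> r k)" by (rule arg_cong)
    then show ?thesis using rpow[OF r[OF k], of n] by (rule trans[THEN sym])
  qed
  \<comment> \<open>For \<open>k = h [^] n \<otimes> r k\<close> this is the inverse of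
    \<open>h [^] n\<close> times \<open>r k\<close>, written without the exponent, so nothing
    depends on the choice of \<open>n\<close>.\<close>
  define x where "x k = r k \<otimes> inv k \<otimes> r k" for k
  have x: "x k \<in> carrier G" if "k \<in> carrier G" for k
    using that r by (simp add: x_def)
  have rx: "r (x k) = r k" if k: "k \<in> carrier G" for k
  proof -
    obtain n :: nat where n: "k = h [^] n \<otimes> r k" using rep[OF k] by blast
    have hn: "h [^] n \<in> carrier G" using h by simp
    have "inv k = inv (h [^] n \<otimes> r k)" using n by (rule arg_cong)
    also have "\<dots> = inv (r k) \<otimes> inv (h [^] n)" by (rule inv_mult_group[OF hn r[OF k]])
    finally have "x k = r k \<otimes> (inv (r k) \<otimes> inv (h [^] n)) \<otimes> r k"
      by (simp only: x_def)
    also have "\<dots> = inv (h [^] n) \<otimes> r k"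
      using r[OF k] hn by (simp add: m_assoc mult_inv_cancel)
    finally have "h [^] n \<otimes> x k = r k"
      using r[OF k] hn by (simp add: mult_inv_cancel)
    then show ?thesis using rpow[OF x[OF k], of n] rr[OF k] by simp
  qed
  have xx: "x (x k) = k" if k: "k \<in> carrier G" for k
  proof -
    have "x (x k) = r k \<otimes> inv (r k \<otimes> inv k \<otimes> r k) \<otimes> r k"
      by (subst x_def) (simp only: rx[OF k], simp only: x_def)
    also have "\<dots> = k"
      using r[OF k] k by (simp add: inv_mult_group m_assoc mult_inv_cancel)
    finally show ?thesis .
  qed
  define y where "y k = h \<otimes> x k" for k
  have y: "y k \<in> carrier G" if "k \<in> carrier G" for k
    using that x h by (simp add: y_def)
  have yy: "y (y k) = k" if k: "k \<in> carrier G" for k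
  proof -
    obtain n :: nat where n: "k = h [^] n \<otimes> r k" using rep[OF k] by blast
    have "y (y k) = h \<otimes> (r k \<otimes> inv (h \<otimes> (r k \<otimes> inv k \<otimes> r k)) \<otimes> r k)"
      using rh[OF x[OF k]] rx[OF k] by (simp add: y_def x_def)
    also have "\<dots> = h \<otimes> (k \<otimes> inv (r k)) \<otimes> inv h \<otimes> r k"
      using r[OF k] k h by (simp add: inv_mult_group m_assoc mult_inv_cancel)
    also have "k \<otimes> inv (r k) = h [^] n"
      by (subst n) (use r[OF k] h in \<open>simp add: m_assoc\<close>)
    also have "h \<otimes> h [^] n \<otimes> inv h = h [^] n"
      using h nat_pow_Suc2[of h n] by (simp add: inv_solve_right')
    also have "h [^] n \<otimes> r k = k" using n by simp
    finally show ?thesis .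
  qed
  have "y (x k) = h \<otimes> k" if "k \<in> carrier G" for k
    using xx[OF that] by (simp add: y_def)
  then show ?thesis using x y xx yy by (intro exI[of _ x] exI[of _ y]) simp
qed

text \<open>Each orbit is a cycle of at least two points. Colours 0 and 1 alternate along it, and
  the base point alone gets colour 2, so that odd cycles also close up properly.\<close>

lemma (in group) left_mult_three_colouring:
  assumes fin: "finite (carrier G)" and h: "h \<in> carrier G" "h \<noteq> \<one>"
  shows "\<exists>c :: 'a \<Rightarrow> nat. \<forall>k\<in>carrier G. c k < 3 \<and> c (h \<otimes> k) \<noteq> c k"
proof -
  obtain r where r_all: "\<forall>k\<in>carrier G.
      r k \<in> carrier G \<and> r (h \<otimes> k) = r k \<and> (\<exists>n::nat. k = h [^] n \<otimes> r k)"
    using powers_representative[OF fin h(1)] by (elim exE)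
  have r: "r k \<in> carrier G" if "k \<in> carrier G" for k
    using bspec[OF r_all that] by (rule conjunct1)
  have rh: "r (h \<otimes> k) = r k" if "k \<in> carrier G" for k
    using bspec[OF r_all that] by (elim conjE)
  have rep: "\<exists>n::nat. k = h [^] n \<otimes> r k" if "k \<in> carrier G" for k
    using bspec[OF r_all that] by (elim conjE)
  define i where "i k = (LEAST n::nat. k = h [^] n \<otimes> r k)" for k
  have i: "k = h [^] i k \<otimes> r k" if "k \<in> carrier G" for k
    unfolding i_def by (rule LeastI_ex) (rule rep[OF that])
  have i_le: "i k \<le> n" if "k = h [^] n \<otimes> r k" for k n
    unfolding i_def by (rule Least_le) (rule that)
  have step: "h [^] Suc n \<otimes> k = h \<otimes> (h [^] n \<otimes> k)" if "k \<in> carrier G" for n :: nat and k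
    using h(1) that by (rule pow_Suc_mult)
  \<comment> \<open>One step along the orbit raises the position by one or returns to the base
    point; a return from the base point itself would give \<open>h = \<one>\<close>.\<close>
  have ih: "i (h \<otimes> k) = Suc (i k) \<or> i (h \<otimes> k) = 0 \<and> i k \<noteq> 0" if k: "k \<in> carrier G" for k
  proof (cases "i (h \<otimes> k)")
    case 0
    then have hk: "h \<otimes> k = r k" using i[of "h \<otimes> k"] rh k h r by simp
    have "i k \<noteq> 0"
    proof
      assume "i k = 0"
      then have "k = r k" using i[OF k] r k by simp
      with hk have "h \<otimes> k = k" by simp
      then show False using h k by (metis r_cancel_one)
    qed
    with 0 show ?thesis by simp
  next
    case (Suc n)
    have "h \<otimes> k = h \<otimes> (h [^] n \<otimes> r k)"
      using i[of "h \<otimes> k"] rh[OF k] k h r step[of "r k" n] Suc by simp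
    then have "k = h [^] n \<otimes> r k" using k h r by simp
    then have "i k \<le> n" by (rule i_le)
    moreover have "i (h \<otimes> k) \<le> Suc (i k)"
      by (rule i_le) (use i[OF k] rh[OF k] step[OF r[OF k], of "i k"] in simp)
    ultimately show ?thesis using Suc by simp
  qed
  show ?thesis
  proof (intro exI[of _ "\<lambda>k. if i k = 0 then 2 else i k mod 2"] ballI conjI)
    fix k assume k: "k \<in> carrier G"
    show "(if i (h \<otimes> k) = 0 then 2 else i (h \<otimes> k) mod 2) \<noteq> (if i k = 0 then 2 else i k mod 2)"
      using ih[OF k] by (auto simp: mod_Suc split: if_splits)
    have "n mod 2 < (3::nat)" for n using mod_less_divisor[of 2 n] by linarith
    then show "(if i k = 0 then 2 else i k mod 2) < 3" by simp
  qed
qed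

section \<open>A linear realization of the encoding\<close>

text \<open>\<open>F'\<close> supplies the inverses, so words act by plain functions, without
  restriction to a carrier set.\<close>

definition word_act :: "('a \<Rightarrow> 's \<Rightarrow> 's) \<Rightarrow> ('a \<Rightarrow> 's \<Rightarrow> 's) \<Rightarrow> 'a word \<Rightarrow> 's \<Rightarrow> 's"
  where "word_act F F' w = foldr (\<lambda>x g. (if snd x then F (fst x) else F' (fst x)) \<circ> g) w id"

lemma word_act_Nil [simp]: "word_act F F' [] s = s"
  and word_act_Cons [simp]:
    "word_act F F' (x # w) s = (if snd x then F (fst x) else F' (fst x)) (word_act F F' w s)"
  by (simp_all add: word_act_def)

lemma word_act_append: "word_act F F' (u @ v) s = word_act F F' u (word_act F F' v s)"
  by (induction u) auto

lemma word_act_map: "word_act F F' (map (map_prod g id) w) s = word_act (F \<circ> g) (F' \<circ> g) w s"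
  by (induction w) auto

lemma restrict_in_Bij:
  assumes "F \<in> M \<rightarrow> M" "F' \<in> M \<rightarrow> M"
    "\<And>m. m \<in> M \<Longrightarrow> F (F' m) = m" "\<And>m. m \<in> M \<Longrightarrow> F' (F m) = m"
  shows "restrict F M \<in> Bij M"
proof -
  have "bij_betw F M M"
    by (rule bij_betw_byWitness[where f' = F']) (use assms in auto)
  then show ?thesis by (simp add: Bij_def)
qed

lemma mult_BijGroup:
  "f \<in> Bij M \<Longrightarrow> restrict G M \<in> Bij M \<Longrightarrow> f \<otimes>\<^bsub>BijGroup M\<^esub> restrict G M = (\<lambda>m\<in>M. f (G m))"
  by (auto simp: BijGroup_def compose_def)

lemma inv_restrict_BijGroup:
  assumes "F \<in> M \<rightarrow> M" "F' \<in> M \<rightarrow> M"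
    "\<And>m. m \<in> M \<Longrightarrow> F (F' m) = m" "\<And>m. m \<in> M \<Longrightarrow> F' (F m) = m"
  shows "inv\<^bsub>BijGroup M\<^esub> (restrict F M) = restrict F' M"
proof (rule group.inv_equality[OF group_BijGroup])
  have F: "restrict F M \<in> Bij M" and F': "restrict F' M \<in> Bij M"
    using assms by (auto intro: restrict_in_Bij)
  show "restrict F' M \<otimes>\<^bsub>BijGroup M\<^esub> restrict F M = \<one>\<^bsub>BijGroup M\<^esub>"
    unfolding mult_BijGroup[OF F' F] unfolding BijGroup_def monoid.simps
  proof (rule restrict_ext)
    fix m assume "m \<in> M"
    then show "restrict F' M (F m) = m" using funcset_mem[OF assms(1)] assms(4) by simp
  qed
  show "restrict F M \<in> carrier (BijGroup M)" "restrict F' M \<in> carrier (BijGroup M)"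
    using F F' by (simp_all add: BijGroup_def)
qed

lemma finite_BijGroup: "finite M \<Longrightarrow> finite (carrier (BijGroup M))"
proof -
  assume "finite M"
  moreover have "Bij M \<subseteq> (M \<rightarrow>\<^sub>E M)"
    by (auto simp: Bij_def bij_betw_def PiE_def)
  ultimately show ?thesis
    by (auto simp: BijGroup_def intro: finite_subset finite_PiE)
qed

text \<open>Reduces relations in a permutation group to pointwise identities between unrestricted
  functions, which is how the relators are checked.\<close>

lemma word_eval_BijGroup:
  assumes maps: "\<And>a. a \<in> A \<Longrightarrow> F a \<in> M \<rightarrow> M" "\<And>a. a \<in> A \<Longrightarrow> F' a \<in> M \<rightarrow> M"
    and inv: "\<And>a m. a \<in> A \<Longrightarrow> m \<in> M \<Longrightarrow> F a (F' a m) = m"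
      "\<And>a m. a \<in> A \<Longrightarrow> m \<in> M \<Longrightarrow> F' a (F a m) = m"
    and w: "w \<in> words A"
  shows "word_eval (BijGroup M) (\<lambda>a. restrict (F a) M) w = restrict (word_act F F' w) M"
proof -
  interpret group "BijGroup M" by (rule group_BijGroup)
  have F: "restrict (F a) M \<in> Bij M" if "a \<in> A" for a
    by (rule restrict_in_Bij[OF maps[OF that] inv[OF that]])
  have F': "restrict (F' a) M \<in> Bij M" if "a \<in> A" for a
    by (rule restrict_in_Bij[OF maps(2,1)[OF that] inv(2,1)[OF that]])
  have closed: "word_eval (BijGroup M) (\<lambda>a. restrict (F a) M) u \<in> Bij M" if "u \<in> words A" for u
  proof -
    have carrier: "carrier (BijGroup M) = Bij M" by (simp add: BijGroup_def)
    have "(\<lambda>a. restrict (F a) M) \<in> A \<rightarrow> carrier (BijGroup M)"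
      unfolding carrier by (rule Pi_I) (rule F)
    from word_eval_closed[OF this that] show ?thesis unfolding carrier .
  qed
  have letter: "letter_eval (BijGroup M) (\<lambda>a. restrict (F a) M) x
      = restrict (if snd x then F (fst x) else F' (fst x)) M" if "fst x \<in> A" for x
    using inv_restrict_BijGroup[OF maps[OF that] inv[OF that]] by (simp add: letter_eval_def)
  show ?thesis using w
  proof (induction w)
    case Nil
    then show ?case by (simp add: BijGroup_def restrict_def)
  next
    case (Cons x w)
    let ?G = "if snd x then F (fst x) else F' (fst x)"
    have x: "fst x \<in> A" and w: "w \<in> words A" using Cons.prems by auto
    note IH = Cons.IH[OF w]
    have tail: "restrict (word_act F F' w) M \<in> Bij M"
      using closed[OF w] unfolding IH .
    have head: "restrict ?G M \<in> Bij M"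
      using F[OF x] F'[OF x] by simp
    have act: "word_act F F' w m \<in> M" if "m \<in> M" for m
      using funcset_mem[OF Bij_imp_funcset[OF tail] that] that by simp
    have "word_eval (BijGroup M) (\<lambda>a. restrict (F a) M) (x # w)
        = restrict ?G M \<otimes>\<^bsub>BijGroup M\<^esub> restrict (word_act F F' w) M"
      unfolding word_eval_Cons letter[OF x] IH ..
    also have "\<dots> = (\<lambda>m\<in>M. restrict ?G M (word_act F F' w m))"
      by (rule mult_BijGroup[OF head tail])
    also have "\<dots> = restrict (word_act F F' (x # w)) M"
      by (rule restrict_ext) (simp add: act)
    finally show ?case .
  qed
qed

section \<open>Block matrices in characteristic two\<close>

definition additive_on :: "'v::ab_group_add set \<Rightarrow> ('v \<Rightarrow> 'v) \<Rightarrow> bool"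
  where "additive_on V f \<longleftrightarrow> (\<forall>p\<in>V. f p \<in> V) \<and> (\<forall>p\<in>V. \<forall>q\<in>V. f (p + q) = f p + f q)"

lemma additive_onD:
  assumes "additive_on V f" "p \<in> V"
  shows "f p \<in> V" "q \<in> V \<Longrightarrow> f (p + q) = f p + f q"
  using assms by (auto simp: additive_on_def)

lemma additive_on_compose: "additive_on V f \<Longrightarrow> additive_on V g \<Longrightarrow> additive_on V (\<lambda>p. f (g p))"
  by (auto simp: additive_on_def)

text \<open>On column vectors \<open>(p, q)\<close> this and the next two maps are the block matrix
  diag(d, 1) and the upper and lower elementary matrices with entries \<open>u\<close> and
  \<open>v\<close>.\<close>

definition diag_map :: "('v \<Rightarrow> 'v) \<Rightarrow> 'v \<times> 'v \<Rightarrow> 'v \<times> 'v"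
  where "diag_map d = (\<lambda>(p, q). (d p, q))"

definition upper_map :: "('v \<Rightarrow> 'v) \<Rightarrow> 'v \<times> 'v \<Rightarrow> 'v::ab_group_add \<times> 'v"
  where "upper_map u = (\<lambda>(p, q). (p + u q, q))"

definition lower_map :: "('v \<Rightarrow> 'v) \<Rightarrow> 'v \<times> 'v \<Rightarrow> 'v \<times> 'v::ab_group_add"
  where "lower_map v = (\<lambda>(p, q). (p, q + v p))"

lemmas block_simps = diag_map_def upper_map_def lower_map_def

lemma word_act_diag_map:
  "word_act (\<lambda>a. diag_map (d a)) (\<lambda>a. diag_map (d' a)) w = diag_map (word_act d d' w)"
proof
  fix m show "word_act (\<lambda>a. diag_map (d a)) (\<lambda>a. diag_map (d' a)) w m = diag_map (word_act d d' w) m"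
    by (induction w) (auto simp: diag_map_def split: prod.splits)
qed

text \<open>Signs disappear, so elementary maps are their own inverses. Closure under sums makes a
  nonempty \<open>V\<close> a subgroup, zero being the double of any member.\<close>

locale char_two_space =
  fixes V :: "'v::ab_group_add set"
  assumes two: "x + x = (0::'v)"
    and closed: "p \<in> V \<Longrightarrow> q \<in> V \<Longrightarrow> p + q \<in> V"
    and finite_V: "finite V"
begin

lemma cancel: "x + (x + y) = (y::'v)"
  by (simp add: two flip: add.assoc)

lemma additive_zero:
  assumes "additive_on V f" "0 \<in> V" shows "f 0 = 0"
  using additive_onD(2)[OF assms(1) assms(2) assms(2)] by simp

text \<open>Both maps are involutions, so this is the commutator of two elementary matrices; since
  \<open>v u = 0\<close>, it reduces to diag(1 + u v, 1).\<close>

lemma comm_upper_lower: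
  assumes "additive_on V u" "additive_on V v" "\<And>p. p \<in> V \<Longrightarrow> v (u p) = 0" "p \<in> V" "q \<in> V"
  shows "upper_map u (lower_map v (upper_map u (lower_map v (p, q)))) = (p + u (v p), q)"
  using assms by (simp add: block_simps additive_onD closed ac_simps two cancel)

text \<open>Conjugation by diag(l, 1) multiplies the upper entry by \<open>l\<close> from the left,
  so the seven maps have entry \<open>(l + 1 + l') u\<close>, which is
  \<open>l' (l l + l + 1) u = 0\<close>.\<close>

lemma kill_upper:
  assumes lam: "additive_on V l" "additive_on V l'" "\<And>p. p \<in> V \<Longrightarrow> l (l' p) = p" "\<And>p. p \<in> V \<Longrightarrow> l' (l p) = p"
    and sq: "\<And>p. p \<in> V \<Longrightarrow> l (l p) + l p + p = 0"
    and u: "additive_on V u" and pq: "p \<in> V" "q \<in> V"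
  shows "diag_map l (upper_map u (diag_map l' (upper_map u (diag_map l' (upper_map u (diag_map l (p, q)))))))
    = (p, q)"
proof -
  let ?z = "u q"
  have z: "?z \<in> V" using u pq by (simp add: additive_onD)
  have "l' (l (l ?z) + l ?z + ?z) = l ?z + ?z + l' ?z"
    using lam z by (simp add: additive_onD closed)
  moreover have "0 \<in> V" using closed[OF z z] by (simp add: two)
  ultimately have sum: "l ?z + ?z + l' ?z = 0"
    using sq[OF z] additive_zero[OF lam(2)] by simp
  have "diag_map l (upper_map u (diag_map l' (upper_map u (diag_map l' (upper_map u (diag_map l (p, q)))))))
    = (p + (l ?z + ?z + l' ?z), q)"
    using lam z pq by (simp add: block_simps additive_onD closed ac_simps)
  then show ?thesis by (simp add: sum)
qed

text \<open>Conjugation now multiplies the entry from the right, so \<open>l + 1 + l'\<close> acts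
  before \<open>v\<close> and additivity of \<open>v\<close> collects the terms.\<close>

lemma kill_lower:
  assumes lam: "additive_on V l" "additive_on V l'" "\<And>p. p \<in> V \<Longrightarrow> l (l' p) = p" "\<And>p. p \<in> V \<Longrightarrow> l' (l p) = p"
    and sq: "\<And>p. p \<in> V \<Longrightarrow> l (l p) + l p + p = 0"
    and v: "additive_on V v" and pq: "p \<in> V" "q \<in> V"
  shows "diag_map l (lower_map v (diag_map l' (lower_map v (diag_map l' (lower_map v (diag_map l (p, q)))))))
    = (p, q)"
proof -
  have "l' (l (l p) + l p + p) = l p + p + l' p"
    using lam pq by (simp add: additive_onD closed)
  moreover have zero: "0 \<in> V" using closed[OF pq(1) pq(1)] by (simp add: two)
  ultimately have sum: "l p + p + l' p = 0"
    using sq[OF pq(1)] additive_zero[OF lam(2)] by simp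
  have "diag_map l (lower_map v (diag_map l' (lower_map v (diag_map l' (lower_map v (diag_map l (p, q)))))))
    = (p, q + (v (l p) + v p + v (l' p)))"
    using lam pq by (simp add: block_simps ac_simps)
  also have "v (l p) + v p + v (l' p) = v (l p + p + l' p)"
    using lam pq v by (simp add: additive_onD closed)
  also have "\<dots> = 0" using additive_zero[OF v zero] by (simp add: sum)
  finally show ?thesis by simp
qed

text \<open>\<open>d a\<close>, \<open>W\<close> and \<open>l\<close> are the operators of the
  letter \<open>a\<close>, of \<open>w\<close> and of \<open>\<Lambda>\<close>. By
  \<open>d_eq\<close>, \<open>d a\<close> is the product of \<open>1 + u1 v1\<close> and
  \<open>1 + u2 v2\<close>, so the elementary maps of the four factors can serve as the auxiliary
  letters.\<close>

lemma realization:
  fixes P :: presentation and d d' u1 v1 u2 v2 :: "nat \<Rightarrow> 'v \<Rightarrow> 'v"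
  defines "I \<equiv> insert 0 (Suc ` set (fst P))"
  assumes P: "finite_presentation P" "w \<in> words (set (fst P))"
    and d: "\<And>a. a \<in> I \<Longrightarrow> additive_on V (d a)" "\<And>a. a \<in> I \<Longrightarrow> additive_on V (d' a)"
      "\<And>a p. a \<in> I \<Longrightarrow> p \<in> V \<Longrightarrow> d a (d' a p) = p" "\<And>a p. a \<in> I \<Longrightarrow> p \<in> V \<Longrightarrow> d' a (d a p) = p"
    and uv: "\<And>a. a \<in> I \<Longrightarrow> additive_on V (u1 a)" "\<And>a. a \<in> I \<Longrightarrow> additive_on V (v1 a)"
      "\<And>a. a \<in> I \<Longrightarrow> additive_on V (u2 a)" "\<And>a. a \<in> I \<Longrightarrow> additive_on V (v2 a)"
      "\<And>a p. a \<in> I \<Longrightarrow> p \<in> V \<Longrightarrow> v1 a (u1 a p) = 0" "\<And>a p. a \<in> I \<Longrightarrow> p \<in> V \<Longrightarrow> v2 a (u2 a p) = 0"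
    and d_eq: "\<And>a p. a \<in> I \<Longrightarrow> p \<in> V \<Longrightarrow>
      d a p = (p + u2 a (v2 a p)) + u1 a (v1 a (p + u2 a (v2 a p)))"
    and rel: "\<And>r p. r \<in> set (snd P) \<Longrightarrow> p \<in> V \<Longrightarrow> word_act (d \<circ> Suc) (d' \<circ> Suc) r p = p"
    and W: "additive_on V W" "additive_on V W'" "\<And>p. p \<in> V \<Longrightarrow> W (W' p) = p" "\<And>p. p \<in> V \<Longrightarrow> W' (W p) = p"
      "\<And>p. p \<in> V \<Longrightarrow> word_act (d \<circ> Suc) (d' \<circ> Suc) w p = W p"
    and l: "\<And>p. l p = W (d 0 (W' (d' 0 p)))" "\<And>p. p \<in> V \<Longrightarrow> l (l p) + l p + p = 0"
    and ne: "p0 \<in> V" "p0 \<noteq> 0"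
  shows "\<exists>(K :: ('v \<times> 'v \<Rightarrow> 'v \<times> 'v) monoid) f. group K \<and> finite (carrier K)
    \<and> f \<in> set (fst (encoding P w)) \<rightarrow> carrier K
    \<and> (\<forall>r\<in>set (snd (encoding P w)). word_eval K f r = \<one>\<^bsub>K\<^esub>)
    \<and> (\<exists>x\<in>set (fst (encoding P w)). f x \<noteq> \<one>\<^bsub>K\<^esub>)"
proof -
  let ?M = "V \<times> V" and ?A = "set (fst (encoding P w))"
  define l' where "l' p = d 0 (W (d' 0 (W' p)))" for p
  have I0: "0 \<in> I" by (simp add: I_def)
  have l_fun: "l = (\<lambda>p. W (d 0 (W' (d' 0 p))))" "l' = (\<lambda>p. d 0 (W (d' 0 (W' p))))"
    using l(1) l'_def by auto
  have l_add: "additive_on V l" "additive_on V l'"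
    unfolding l_fun
    using additive_on_compose[OF W(1) additive_on_compose[OF d(1)[OF I0] additive_on_compose[OF W(2) d(2)[OF I0]]]]
      additive_on_compose[OF d(1)[OF I0] additive_on_compose[OF W(1) additive_on_compose[OF d(2)[OF I0] W(2)]]]
    by simp_all
  have l_inv: "l (l' p) = p" "l' (l p) = p" if "p \<in> V" for p
    using that d[OF I0] W by (simp_all add: l_fun additive_onD)
  \<comment> \<open>The second component is the index given to \<open>gen\<close>. Elementary maps
    are their own inverses, so \<open>F\<close> and \<open>F'\<close> differ only in the diagonal
    maps.\<close>
  define F where "F n = (case prod_decode n of (a, i) \<Rightarrow>
    if i = 0 then diag_map (d a) else if i = 1 then upper_map (u1 a) else if i = 2 then lower_map (v1 a)
    else if i = 3 then upper_map (u2 a) else if i = 4 then lower_map (v2 a)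
    else if i = 5 then diag_map l else diag_map W)" for n
  define F' where "F' n = (case prod_decode n of (a, i) \<Rightarrow>
    if i = 0 then diag_map (d' a) else if i = 1 then upper_map (u1 a) else if i = 2 then lower_map (v1 a)
    else if i = 3 then upper_map (u2 a) else if i = 4 then lower_map (v2 a)
    else if i = 5 then diag_map l' else diag_map W')" for n
  have F_gen: "F (gen 0 a) = diag_map (d a)" "F (gen 1 a) = upper_map (u1 a)" "F (gen 2 a) = lower_map (v1 a)"
    "F (gen 3 a) = upper_map (u2 a)" "F (gen 4 a) = lower_map (v2 a)" "F (gen 5 a) = diag_map l"
    "F (gen 6 a) = diag_map W" "F (gen (Suc 0) a) = upper_map (u1 a)" for a
    by (simp_all add: F_def gen_def)
  have F'_gen: "F' (gen 0 a) = diag_map (d' a)" "F' (gen 1 a) = upper_map (u1 a)" "F' (gen 2 a) = lower_map (v1 a)"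
    "F' (gen 3 a) = upper_map (u2 a)" "F' (gen 4 a) = lower_map (v2 a)" "F' (gen 5 a) = diag_map l'"
    "F' (gen 6 a) = diag_map W'" "F' (gen (Suc 0) a) = upper_map (u1 a)" for a
    by (simp_all add: F'_def gen_def)
  define inverse_pair where "inverse_pair G G' \<longleftrightarrow> G \<in> ?M \<rightarrow> ?M \<and> G' \<in> ?M \<rightarrow> ?M
    \<and> (\<forall>m\<in>?M. G (G' m) = m \<and> G' (G m) = m)" for G G' :: "'v \<times> 'v \<Rightarrow> 'v \<times> 'v"
  have diag: "inverse_pair (diag_map f) (diag_map g)"
    if "additive_on V f" "additive_on V g" "\<And>p. p \<in> V \<Longrightarrow> f (g p) = p" "\<And>p. p \<in> V \<Longrightarrow> g (f p) = p" for f g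
    unfolding inverse_pair_def using that by (auto simp: diag_map_def additive_onD)
  have upper: "inverse_pair (upper_map f) (upper_map f)" if "additive_on V f" for f
    unfolding inverse_pair_def using that
    by (auto simp: upper_map_def additive_onD closed two add.assoc)
  have lower: "inverse_pair (lower_map f) (lower_map f)" if "additive_on V f" for f
    unfolding inverse_pair_def using that
    by (auto simp: lower_map_def additive_onD closed two add.assoc)
  have F: "inverse_pair (F x) (F' x)" if "x \<in> ?A" for x
  proof -
    have "x \<in> (\<Union>a\<in>I. set (letter_gens a)) \<union> {gen 5 0, gen 6 0}"
      using that by (simp only: encoding_def fst_conv set_encoding_gens I_def)
    then consider a where "a \<in> I" "x \<in> set (letter_gens a)" | "x = gen 5 0" | "x = gen 6 0"
      by blast
    then show ?thesis
    proof cases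
      case (1 a)
      from 1(2) have "x = gen 0 a \<or> x = gen 1 a \<or> x = gen 2 a \<or> x = gen 3 a \<or> x = gen 4 a"
        by (simp add: letter_gens_def)
      moreover have "inverse_pair (diag_map (d a)) (diag_map (d' a))"
        using 1(1) by (intro diag d)
      moreover have "inverse_pair (upper_map (u1 a)) (upper_map (u1 a))" "inverse_pair (lower_map (v1 a)) (lower_map (v1 a))"
        "inverse_pair (upper_map (u2 a)) (upper_map (u2 a))" "inverse_pair (lower_map (v2 a)) (lower_map (v2 a))"
        using 1(1) by (intro upper lower uv; assumption)+
      ultimately show ?thesis
        by (elim disjE) (simp_all only: F_gen F'_gen)
    next
      case 2
      show ?thesis unfolding 2 F_gen F'_gen by (rule diag[OF l_add l_inv])
    next
      case 3
      show ?thesis unfolding 3 F_gen F'_gen by (rule diag[OF W(1-4)])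
    qed
  qed
  have embed: "word_act F F' (map embed_letter r) m = diag_map (word_act (d \<circ> Suc) (d' \<circ> Suc) r) m" for r m
  proof -
    have "F \<circ> (\<lambda>a. gen 0 (Suc a)) = (\<lambda>a. diag_map ((d \<circ> Suc) a))"
      "F' \<circ> (\<lambda>a. gen 0 (Suc a)) = (\<lambda>a. diag_map ((d' \<circ> Suc) a))"
      by (auto simp: F_gen F'_gen)
    then show ?thesis by (simp only: embed_letter_def word_act_map word_act_diag_map)
  qed
  have rels: "word_act F F' r m = m" if r: "r \<in> set (snd (encoding P w))" and m: "m \<in> ?M" for r m
  proof -
    obtain p q where pq: "m = (p, q)" "p \<in> V" "q \<in> V" using m by blast
    have kill_act: "word_act F F' (kill_word x y) m
      = F x (F y (F' x (F' y (F' x (F y (F x m))))))" for x y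
      by (simp add: kill_word_def)
    have ku: "diag_map l (upper_map u (diag_map l' (upper_map u (diag_map l' (upper_map u (diag_map l (p, q)))))))
        = (p, q)" if "additive_on V u" for u
      using l_add l_inv l(2) that pq(2,3) by (rule kill_upper)
    have kl: "diag_map l (lower_map v (diag_map l' (lower_map v (diag_map l' (lower_map v (diag_map l (p, q)))))))
        = (p, q)" if "additive_on V v" for v
      using l_add l_inv l(2) that pq(2,3) by (rule kill_lower)
    have "r \<in> map embed_letter ` set (snd P) \<union> (\<Union>a\<in>I. set (letter_rels a))
        \<union> {neg (gen 6 0) # map embed_letter w, neg (gen 5 0) # comm_word (gen 6 0) (gen 0 0)}"
      using r by (simp only: encoding_def snd_conv set_encoding_rels I_def)
    then consider r' where "r' \<in> set (snd P)" "r = map embed_letter r'"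
      | a where "a \<in> I" "r \<in> set (letter_rels a)"
      | "r = neg (gen 6 0) # map embed_letter w"
      | "r = neg (gen 5 0) # comm_word (gen 6 0) (gen 0 0)"
      by blast
    then consider r' where "r' \<in> set (snd P)" "r = map embed_letter r'"
      | a where "a \<in> I" "r = neg (gen 0 a) # comm_word (gen 1 a) (gen 2 a) @ comm_word (gen 3 a) (gen 4 a)"
      | a where "a \<in> I" "r = kill_word (gen 5 0) (gen 1 a) \<or> r = kill_word (gen 5 0) (gen 2 a)
          \<or> r = kill_word (gen 5 0) (gen 3 a) \<or> r = kill_word (gen 5 0) (gen 4 a)"
      | "r = neg (gen 6 0) # map embed_letter w"
      | "r = neg (gen 5 0) # comm_word (gen 6 0) (gen 0 0)"
    proof cases
      case (2 a)
      from 2(2) show ?thesis unfolding letter_rels_def using 2(1) that(2,3) by (simp only: list.set) blast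
    qed (rule that; assumption)+
    then show ?thesis
    proof cases
      case 1
      then show ?thesis using rel pq by (simp add: embed diag_map_def)
    next
      case (2 a)
      \<comment> \<open>Words act from the right: the second commutator takes \<open>p\<close> to
        \<open>?s\<close>, the first one then gives \<open>d a p\<close>, and the leading inverse
        letter undoes it.\<close>
      let ?s = "p + u2 a (v2 a p)"
      have s: "?s \<in> V" using pq uv[OF 2(1)] by (simp add: additive_onD closed)
      have "word_act F F' r m = diag_map (d' a) (upper_map (u1 a) (lower_map (v1 a) (upper_map (u1 a) (lower_map (v1 a)
         (upper_map (u2 a) (lower_map (v2 a) (upper_map (u2 a) (lower_map (v2 a) m))))))))"
        by (simp only: 2(2) comm_word_def word_act_Cons word_act_append word_act_Nil append.simps
            F_gen F'_gen fst_conv snd_conv if_True if_False)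
      also have "\<dots> = diag_map (d' a) (?s + u1 a (v1 a ?s), q)"
        using comm_upper_lower[OF uv(3,4,6)[OF 2(1)] pq(2,3)] comm_upper_lower[OF uv(1,2,5)[OF 2(1)] s pq(3)]
        by (simp only: pq(1))
      also have "\<dots> = m"
        using d(4)[OF 2(1) pq(2)] d_eq[OF 2(1) pq(2)] pq by (simp add: diag_map_def)
      finally show ?thesis .
    next
      case (3 a)
      have k: "word_act F F' (kill_word (gen 5 0) (gen 1 a)) m = m"
        "word_act F F' (kill_word (gen 5 0) (gen 2 a)) m = m"
        "word_act F F' (kill_word (gen 5 0) (gen 3 a)) m = m"
        "word_act F F' (kill_word (gen 5 0) (gen 4 a)) m = m"
        unfolding kill_act unfolding F_gen F'_gen pq(1) using 3(1) by (intro ku kl uv; assumption)+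
      from 3(2) show ?thesis by (elim disjE) (simp_all only: k)
    next
      case 4
      then show ?thesis using W(4,5) pq by (simp add: embed F'_gen diag_map_def)
    next
      case 5
      then show ?thesis using l_inv(2)[OF pq(2)] pq
        by (simp add: comm_word_def F_gen F'_gen diag_map_def flip: l(1))
    qed
  qed
  define f where "f x = restrict (F x) ?M" for x
  have f: "f \<in> ?A \<rightarrow> carrier (BijGroup ?M)"
  proof
    fix x assume "x \<in> ?A"
    then have "restrict (F x) ?M \<in> Bij ?M"
      using F[of x] restrict_in_Bij[of "F x" ?M "F' x"] unfolding inverse_pair_def by blast
    then show "f x \<in> carrier (BijGroup ?M)" by (simp add: f_def BijGroup_def)
  qed
  have "word_eval (BijGroup ?M) f r = \<one>\<^bsub>BijGroup ?M\<^esub>" if r: "r \<in> set (snd (encoding P w))" for r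
  proof -
    have "r \<in> words ?A"
      using finite_presentation_encoding[OF P] r by (auto simp: finite_presentation_def)
    then have "word_eval (BijGroup ?M) f r = restrict (word_act F F' r) ?M"
      unfolding f_def
      by (intro word_eval_BijGroup) (use F in \<open>auto simp only: inverse_pair_def\<close>)
    also have "\<dots> = \<one>\<^bsub>BijGroup ?M\<^esub>"
      using rels[OF r] by (auto simp: BijGroup_def intro!: restrict_ext)
    finally show ?thesis .
  qed
  moreover have "f (gen 5 0) \<noteq> \<one>\<^bsub>BijGroup ?M\<^esub>"
  proof
    assume "f (gen 5 0) = \<one>\<^bsub>BijGroup ?M\<^esub>"
    \<comment> \<open>At a fixed point of \<open>l\<close> the quadratic relation reads
      \<open>p0 + p0 + p0 = 0\<close>, which forces \<open>p0 = 0\<close>.\<close>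
    from fun_cong[OF this, of "(p0, p0)"] have "l p0 = p0"
      using ne by (simp add: f_def F_gen BijGroup_def diag_map_def)
    then show False using l(2)[OF ne(1)] ne(2) by (simp add: two)
  qed
  moreover have "gen 5 0 \<in> ?A" by (simp add: encoding_def set_encoding_gens)
  moreover have "finite (carrier (BijGroup ?M))" by (simp add: finite_BijGroup finite_V)
  ultimately show ?thesis using f group_BijGroup by blast
qed

end

section \<open>Functions with values in the field of four elements\<close>

lemma bit_add_self [simp]: "x + x = (0::bit)" "x + (x + y) = (y::bit)"
  by (cases x; cases y; simp)+

text \<open>Functions on \<open>C\<close> are extended by zero, so that they form a subset of a type
  with pointwise addition.\<close>

definition supported :: "'k set \<Rightarrow> ('k \<Rightarrow> bit \<times> bit) set"
  where "supported C = {p. \<forall>k. k \<notin> C \<longrightarrow> p k = 0}"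

text \<open>The linear action of a self-map of \<open>C\<close>. It reverses composition:
  \<open>pull C x (pull C y p)\<close> evaluates \<open>p\<close> at \<open>y (x k)\<close>.\<close>

definition pull :: "'k set \<Rightarrow> ('k \<Rightarrow> 'k) \<Rightarrow> ('k \<Rightarrow> bit \<times> bit) \<Rightarrow> 'k \<Rightarrow> bit \<times> bit"
  where "pull C \<pi> p = (\<lambda>k. if k \<in> C then p (\<pi> k) else 0)"

lemma char_two_space_supported:
  assumes "finite C"
  shows "char_two_space (supported C)"
proof
  fix x :: "'a \<Rightarrow> bit \<times> bit"
  show "x + x = 0" by (simp add: fun_eq_iff prod_eq_iff)
next
  have "UNIV = {0, 1::bit}" by (auto intro: bit.exhaust)
  then have "finite (UNIV :: bit set)" by (metis finite.emptyI finite.insertI)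
  then have "finite (UNIV :: (bit \<times> bit) set)" by (simp add: finite_prod)
  then show "finite (supported C)"
    using finite_set_of_finite_funs[OF assms, of "UNIV :: (bit \<times> bit) set" 0]
    by (auto simp: supported_def)
qed (auto simp: supported_def)

lemma additive_on_pull: "\<pi> \<in> C \<rightarrow> C \<Longrightarrow> additive_on (supported C) (pull C \<pi>)"
  by (auto simp: additive_on_def supported_def pull_def fun_eq_iff)

text \<open>With \<open>s = pull C \<pi>\<close>, take \<open>u = 1 + s\<close> and let \<open>v\<close> be \<open>1 + s\<close> cut down to one point of every
  two-element orbit.\<close>

lemma involution_factorization:
  assumes C: "finite C" and \<pi>: "\<pi> \<in> C \<rightarrow> C" "\<forall>k\<in>C. \<pi> (\<pi> k) = k"
  shows "\<exists>u v. additive_on (supported C) u \<and> additive_on (supported C) v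
    \<and> (\<forall>p\<in>supported C. v (u p) = 0 \<and> p + u (v p) = pull C \<pi> p)"
proof -
  \<comment> \<open>The numbering singles out the smaller point of each two-element orbit.\<close>
  obtain \<iota> :: "'a \<Rightarrow> nat" where \<iota>: "inj_on \<iota> C"
    using finite_imp_inj_to_nat_seg[OF C] by blast
  have \<pi>C: "\<pi> k \<in> C" "\<pi> (\<pi> k) = k" if "k \<in> C" for k using \<pi> that by blast+
  define u :: "('a \<Rightarrow> bit \<times> bit) \<Rightarrow> 'a \<Rightarrow> bit \<times> bit"
    where "u p = (\<lambda>k. if k \<in> C then p k + p (\<pi> k) else 0)" for p
  define v :: "('a \<Rightarrow> bit \<times> bit) \<Rightarrow> 'a \<Rightarrow> bit \<times> bit"
    where "v p = (\<lambda>k. if k \<in> C \<and> \<iota> k < \<iota> (\<pi> k) then p k + p (\<pi> k) else 0)" for p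
  show ?thesis
  proof (rule exI[of _ u], rule exI[of _ v], intro ballI conjI)
    show "additive_on (supported C) u" "additive_on (supported C) v"
      by (auto simp: additive_on_def supported_def u_def v_def fun_eq_iff)
    \<comment> \<open>\<open>u p\<close> takes the same value at \<open>k\<close> and at
      \<open>\<pi> k\<close>, so their sum vanishes.\<close>
    show "v (u p) = 0" for p
    proof
      fix k show "v (u p) k = 0 k"
        by (auto simp: u_def v_def \<pi>C prod_eq_iff add.commute)
    qed
    show "p + u (v p) = pull C \<pi> p" if p: "p \<in> supported C" for p
    proof
      fix k
      show "(p + u (v p)) k = pull C \<pi> p k"
      proof (cases "k \<in> C")
        case True
        \<comment> \<open>On a two-element orbit \<open>v p\<close> lives on one point, so
          \<open>u (v p)\<close> adds \<open>p k + p (\<pi> k)\<close> at both and thereby swaps the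
          values; at a fixed point it adds nothing.\<close>
        consider "\<iota> k < \<iota> (\<pi> k)" | "\<iota> (\<pi> k) < \<iota> k" | "\<pi> k = k"
          using \<iota> True \<pi>C(1)[OF True] by (metis inj_onD linorder_neqE_nat)
        then show ?thesis
          by cases (auto simp: u_def v_def pull_def True \<pi>C prod_eq_iff add.commute)
      next
        case False
        then show ?thesis using p by (simp add: u_def pull_def supported_def)
      qed
    qed
  qed
qed

text \<open>Reading \<open>(x, y)\<close> as \<open>x + y \<omega>\<close> with
  \<open>\<omega>\<^sup>2 = \<omega> + 1\<close>, this is multiplication by \<open>\<omega>\<close>
  to the power \<open>i\<close>, for \<open>i < 3\<close>.\<close>

definition rot :: "nat \<Rightarrow> bit \<times> bit \<Rightarrow> bit \<times> bit"
  where "rot i x = (if i = 0 then x else if i = 1 then (snd x, fst x + snd x) else (fst x + snd x, fst x))"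

definition rot_inv :: "nat \<Rightarrow> bit \<times> bit \<Rightarrow> bit \<times> bit"
  where "rot_inv i x = (if i = 0 then x else if i = 1 then (fst x + snd x, fst x) else (snd x, fst x + snd x))"

lemma rot_inverse: "rot i (rot_inv i x) = x" "rot_inv i (rot i x) = x"
  by (auto simp: rot_def rot_inv_def prod_eq_iff ac_simps)

lemma rot_add: "rot i (x + y) = rot i x + rot i y" "rot_inv i (x + y) = rot_inv i x + rot_inv i y"
  by (auto simp: rot_def rot_inv_def prod_eq_iff ac_simps)

text \<open>\<open>rot i\<close> after \<open>rot_inv j\<close> multiplies by
  \<open>\<omega>\<close> to the power \<open>i - j\<close>, a primitive cube root of unity.\<close>

lemma rot_quadratic:
  assumes "i < 3" "j < 3" "i \<noteq> j"
  shows "rot i (rot_inv j (rot i (rot_inv j x))) + rot i (rot_inv j x) + x = 0"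
proof -
  have "(i, j) \<in> {(0, 1), (0, 2), (1, 0), (1, 2), (2, 0), (2, 1)}"
    using assms by auto
  then show ?thesis
    by (auto simp: rot_def rot_inv_def prod_eq_iff ac_simps)
qed

definition factors_through :: "'v::ab_group_add set \<Rightarrow> ('v \<Rightarrow> 'v) \<Rightarrow>
    ('v \<Rightarrow> 'v) \<Rightarrow> ('v \<Rightarrow> 'v) \<Rightarrow> ('v \<Rightarrow> 'v) \<Rightarrow> ('v \<Rightarrow> 'v) \<Rightarrow> bool"
  where "factors_through V d u1 v1 u2 v2 \<longleftrightarrow>
    additive_on V u1 \<and> additive_on V v1 \<and> additive_on V u2 \<and> additive_on V v2 \<and>
    (\<forall>p\<in>V. v1 (u1 p) = 0 \<and> v2 (u2 p) = 0
      \<and> d p = (p + u2 (v2 p)) + u1 (v1 (p + u2 (v2 p))))"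

text \<open>\<open>rot 1\<close> and \<open>rot 2\<close> are the products of the transvections
  \<open>(x, y) -> (x + y, y)\<close> and \<open>(x, y) -> (x, x + y)\<close> in the two orders.
  Hence the factors change places between colours 1 and 2, and vanish for colour 0.\<close>

lemma factors_through_rot:
  "\<exists>u1 v1 u2 v2. factors_through (supported C) (\<lambda>p k. if k \<in> C then rot (c k) (p k) else 0) u1 v1 u2 v2"
proof -
  define \<phi> where "\<phi> i s t x = (if i = (0::nat) then 0 else if i = 1 then s x else t x)"
    for i and s t :: "bit \<times> bit \<Rightarrow> bit \<times> bit" and x
  define m where "m s t p = (\<lambda>k. if k \<in> C then \<phi> (c k) s t (p k) else 0)"
    for s t and p :: "'a \<Rightarrow> bit \<times> bit"
  let ?u1 = "\<lambda>x::bit \<times> bit. (snd x, 0::bit)" and ?v1 = "\<lambda>x::bit \<times> bit. (0::bit, snd x)"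
  let ?u2 = "\<lambda>x::bit \<times> bit. (0::bit, fst x)" and ?v2 = "\<lambda>x::bit \<times> bit. (fst x, 0::bit)"
  have "factors_through (supported C) (\<lambda>p k. if k \<in> C then rot (c k) (p k) else 0)
    (m ?u1 ?u2) (m ?v1 ?v2) (m ?u2 ?u1) (m ?v2 ?v1)"
    by (auto simp: factors_through_def additive_on_def supported_def m_def \<phi>_def rot_def
        fun_eq_iff prod_eq_iff ac_simps)
  then show ?thesis by blast
qed

lemma (in group) factors_through_left_mult:
  assumes fin: "finite (carrier G)" and h: "h \<in> carrier G"
  shows "\<exists>u1 v1 u2 v2. factors_through (supported (carrier G)) (pull (carrier G) (\<lambda>k. h \<otimes> k)) u1 v1 u2 v2"
proof -
  obtain x y where x: "x \<in> carrier G \<rightarrow> carrier G" and y: "y \<in> carrier G \<rightarrow> carrier G"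
    and xy: "\<forall>k\<in>carrier G. x (x k) = k \<and> y (y k) = k \<and> y (x k) = h \<otimes> k"
    using left_mult_product_of_involutions[OF assms] by (elim exE conjE)
  have xx: "\<forall>k\<in>carrier G. x (x k) = k" and yy: "\<forall>k\<in>carrier G. y (y k) = k"
    and yx: "\<And>k. k \<in> carrier G \<Longrightarrow> y (x k) = h \<otimes> k"
    using xy by blast+
  obtain u1 v1 where 1: "additive_on (supported (carrier G)) u1" "additive_on (supported (carrier G)) v1"
    "\<forall>p\<in>supported (carrier G). v1 (u1 p) = 0 \<and> p + u1 (v1 p) = pull (carrier G) x p"
    using involution_factorization[OF fin x xx] by (elim exE conjE)
  obtain u2 v2 where 2: "additive_on (supported (carrier G)) u2" "additive_on (supported (carrier G)) v2"
    "\<forall>p\<in>supported (carrier G). v2 (u2 p) = 0 \<and> p + u2 (v2 p) = pull (carrier G) y p"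
    using involution_factorization[OF fin y yy] by (elim exE conjE)
  have "pull (carrier G) (\<lambda>k. h \<otimes> k) p = pull (carrier G) x (pull (carrier G) y p)" for p
    using x by (auto simp: pull_def fun_eq_iff yx)
  moreover have "pull (carrier G) y p \<in> supported (carrier G)" for p
    by (simp add: pull_def supported_def)
  ultimately have "factors_through (supported (carrier G)) (pull (carrier G) (\<lambda>k. h \<otimes> k)) u1 v1 u2 v2"
    using 1 2 by (simp add: factors_through_def)
  then show ?thesis by blast
qed

lemma (in group) nontrivial_quotient_of_encoding:
  assumes fin: "finite (carrier G)"
    and P: "finite_presentation P" "w \<in> words (set (fst P))"
    and f: "f \<in> set (fst P) \<rightarrow> carrier G"
    and rel: "\<And>r. r \<in> set (snd P) \<Longrightarrow> word_eval G f r = \<one>"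
    and w: "word_eval G f w \<noteq> \<one>"
  shows "\<exists>(K :: (('a \<Rightarrow> bit \<times> bit) \<times> ('a \<Rightarrow> bit \<times> bit) \<Rightarrow> ('a \<Rightarrow> bit \<times> bit) \<times> ('a \<Rightarrow> bit \<times> bit)) monoid) f.
    group K \<and> finite (carrier K)
    \<and> f \<in> set (fst (encoding P w)) \<rightarrow> carrier K
    \<and> (\<forall>r\<in>set (snd (encoding P w)). word_eval K f r = \<one>\<^bsub>K\<^esub>)
    \<and> (\<exists>x\<in>set (fst (encoding P w)). f x \<noteq> \<one>\<^bsub>K\<^esub>)"
proof -
  let ?C = "carrier G" and ?I = "insert 0 (Suc ` set (fst P))"
  let ?V = "supported ?C"
  let ?L = "\<lambda>h. pull ?C (\<lambda>k. h \<otimes> k)"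
  interpret char_two_space ?V by (rule char_two_space_supported[OF fin])
  define g where "g = word_eval G f w"
  have g: "g \<in> ?C" unfolding g_def using f P(2) by (rule word_eval_closed)
  \<comment> \<open>\<open>w\<close> is going to act by \<open>?L (inv g)\<close>, so the orbits to
    be coloured are those of \<open>inv g\<close>.\<close>
  have "inv g \<in> ?C" "inv g \<noteq> \<one>" using g w by (auto simp: g_def)
  from left_mult_three_colouring[OF fin this]
  obtain c :: "'a \<Rightarrow> nat" where c_all: "\<forall>k\<in>?C. c k < 3 \<and> c (inv g \<otimes> k) \<noteq> c k"
    by (elim exE)
  have c: "c k < 3" "c (inv g \<otimes> k) \<noteq> c k" if "k \<in> ?C" for k
    using c_all that by simp_all
  have L_add: "additive_on ?V (?L h)" if "h \<in> ?C" for h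
    using that by (intro additive_on_pull) auto
  have L_mult: "?L h (?L h' p) = ?L (h' \<otimes> h) p" if "h \<in> ?C" "h' \<in> ?C" for h h' p
    using that by (auto simp: pull_def fun_eq_iff m_assoc)
  have L_one: "?L \<one> p = p" if "p \<in> ?V" for p
    using that by (auto simp: pull_def fun_eq_iff supported_def)
  define b where "b p = (\<lambda>k. if k \<in> ?C then rot (c k) (p k) else 0)" for p
  define b' where "b' p = (\<lambda>k. if k \<in> ?C then rot_inv (c k) (p k) else 0)" for p
  have b_add: "additive_on ?V b" "additive_on ?V b'"
    by (auto simp: additive_on_def supported_def b_def b'_def rot_add fun_eq_iff)
  have b_inv: "b (b' p) = p" "b' (b p) = p" if "p \<in> ?V" for p
    using that by (auto simp: supported_def b_def b'_def rot_inverse fun_eq_iff)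
  \<comment> \<open>\<open>?L\<close> reverses products; inserting inverses makes words act in their
    own order.\<close>
  define d where "d a = (case a of 0 \<Rightarrow> b | Suc a \<Rightarrow> ?L (inv (f a)))" for a
  define d' where "d' a = (case a of 0 \<Rightarrow> b' | Suc a \<Rightarrow> ?L (f a))" for a
  have fc: "f a \<in> ?C" if "a \<in> set (fst P)" for a using f that by blast
  have factors: "\<exists>u1 v1 u2 v2. factors_through ?V (d a) u1 v1 u2 v2" if "a \<in> ?I" for a
  proof (cases a)
    case 0
    have "b = (\<lambda>p k. if k \<in> ?C then rot (c k) (p k) else 0)" by (simp add: b_def fun_eq_iff)
    with 0 have "d a = (\<lambda>p k. if k \<in> ?C then rot (c k) (p k) else 0)" by (simp add: d_def)
    then show ?thesis using factors_through_rot[of ?C c] by (simp only:)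
  next
    case (Suc a')
    with that have "inv (f a') \<in> ?C" using fc by auto
    from factors_through_left_mult[OF fin this] show ?thesis by (simp add: d_def Suc)
  qed
  obtain u1 v1 u2 v2 where uv: "\<And>a. a \<in> ?I \<Longrightarrow> factors_through ?V (d a) (u1 a) (v1 a) (u2 a) (v2 a)"
    using factors by metis
  have act: "word_act (d \<circ> Suc) (d' \<circ> Suc) r p = ?L (inv (word_eval G f r)) p"
    if "r \<in> words (set (fst P))" "p \<in> ?V" for r p
    using that(1)
  proof (induction r)
    case Nil
    then show ?case using L_one[OF that(2)] by simp
  next
    case (Cons x r)
    have xr: "fst x \<in> set (fst P)" "r \<in> words (set (fst P))" using Cons.prems by auto
    have closed: "letter_eval G f x \<in> ?C" "word_eval G f r \<in> ?C"
      using letter_eval_closed[OF f xr(1)] word_eval_closed[OF f xr(2)] by auto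
    have "(if snd x then (d \<circ> Suc) (fst x) else (d' \<circ> Suc) (fst x)) = ?L (inv (letter_eval G f x))"
      using fc[OF xr(1)] by (simp add: d_def d'_def letter_eval_def)
    then have "word_act (d \<circ> Suc) (d' \<circ> Suc) (x # r) p
        = ?L (inv (letter_eval G f x)) (?L (inv (word_eval G f r)) p)"
      using Cons.IH[OF xr(2)] by (simp only: word_act_Cons)
    also have "\<dots> = ?L (inv (word_eval G f (x # r))) p"
      using closed by (simp add: L_mult word_eval_Cons inv_mult_group)
    finally show ?case .
  qed
  define l where "l p = ?L (inv g) (d 0 (?L g (d' 0 p)))" for p
  \<comment> \<open>The shifts by \<open>g\<close> and its inverse cancel, so \<open>l\<close> only
    multiplies the value at \<open>k\<close> by a power of \<open>\<omega>\<close>, with exponent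
    the difference of two distinct colours.\<close>
  have l_eq: "l p k = (if k \<in> ?C then rot (c (inv g \<otimes> k)) (rot_inv (c k) (p k)) else 0)" for p k
    using g by (simp add: l_def d_def d'_def pull_def b_def b'_def mult_inv_cancel)
  show ?thesis
  proof (rule realization[where d = d and d' = d' and ?u1.0 = u1 and ?v1.0 = v1 and ?u2.0 = u2 and ?v2.0 = v2
        and W = "?L (inv g)" and W' = "?L g" and l = l, OF P])
    fix a assume a: "a \<in> ?I"
    show "additive_on ?V (d a)" "additive_on ?V (d' a)"
      using a fc b_add by (auto simp: d_def d'_def L_add)
    show "d a (d' a p) = p" "d' a (d a p) = p" if "p \<in> ?V" for p
      using a fc b_inv[OF that] that by (auto simp: d_def d'_def L_mult L_one)
    show "additive_on ?V (u1 a)" "additive_on ?V (v1 a)" "additive_on ?V (u2 a)" "additive_on ?V (v2 a)"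
      using uv[OF a] by (simp_all add: factors_through_def)
    show "v1 a (u1 a p) = 0" "v2 a (u2 a p) = 0"
      "d a p = p + u2 a (v2 a p) + u1 a (v1 a (p + u2 a (v2 a p)))" if "p \<in> ?V" for p
      using uv[OF a] that unfolding factors_through_def by blast+
  next
    fix r p assume "r \<in> set (snd P)" "p \<in> ?V"
    then show "word_act (d \<circ> Suc) (d' \<circ> Suc) r p = p"
      using act[of r p] rel[of r] P(1) L_one[of p] by (auto simp: finite_presentation_def)
  next
    show "additive_on ?V (?L (inv g))" "additive_on ?V (?L g)"
      using g by (simp_all add: L_add)
    show "?L (inv g) (?L g p) = p" "?L g (?L (inv g) p) = p" if "p \<in> ?V" for p
      using g that by (simp_all add: L_mult L_one)
    show "word_act (d \<circ> Suc) (d' \<circ> Suc) w p = ?L (inv g) p" if "p \<in> ?V" for p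
      using act[OF P(2) that] by (simp add: g_def)
  next
    fix p assume p: "p \<in> ?V"
    show "l (l p) + l p + p = 0"
    proof
      fix k
      show "(l (l p) + l p + p) k = 0 k"
      proof (cases "k \<in> ?C")
        case True
        then have "c (inv g \<otimes> k) < 3" using g by (intro c(1)) simp
        from rot_quadratic[OF this c(1)[OF True] c(2)[OF True], of "p k"] True show ?thesis
          by (simp add: l_eq)
      next
        case False
        then show ?thesis using p by (simp add: l_eq supported_def)
      qed
    qed
  next
    show "(\<lambda>k. if k = \<one> then (1, 1) else 0) \<in> ?V" by (auto simp: supported_def)
    show "(\<lambda>k. if k = \<one> then (1, 1) else (0 :: bit \<times> bit)) \<noteq> 0"
      by (auto simp: fun_eq_iff zero_prod_def)
  qed (simp_all add: l_def)
qed

section \<open>The two directions of the equivalence\<close>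

theorem theorem3:
  shows "\<exists>p :: recf. \<forall>(P :: presentation) (w :: nat word).
    finite_presentation P \<and> w \<in> words (set (fst P)) \<longrightarrow>
    (\<exists>Q :: presentation. finite_presentation Q \<and>
       computes p [encode_presentation P, encode_word w] (encode_presentation Q) \<and>
       (trivial_group (profinite_completion (group_of Q)) \<longleftrightarrow>
        to_profinite (group_of P) (element_of P w) = \<one>\<^bsub>profinite_completion (group_of P)\<^esub>))"
proof -
  obtain p where p: "computes p [encode_presentation P, encode_word w] (encode_presentation (encoding P w))" for P w
    using encoding_computable by blast
  have "trivial_group (profinite_completion (group_of (encoding P w))) \<longleftrightarrow>
      to_profinite (group_of P) (element_of P w) = \<one>\<^bsub>profinite_completion (group_of P)\<^esub>"
    if P: "finite_presentation P" "w \<in> words (set (fst P))" for P w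
  proof -
    let ?Q = "encoding P w"
    have Q: "finite_presentation ?Q" by (rule finite_presentation_encoding[OF P])
    have RP: "set (snd P) \<subseteq> words (set (fst P))" and RQ: "set (snd ?Q) \<subseteq> words (set (fst ?Q))"
      using P(1) Q by (simp_all add: finite_presentation_def)
    have gen: "[(a, True)] \<in> words (set (fst ?Q))" if "a \<in> set (fst ?Q)" for a using that by simp
    have "to_profinite (group_of P) (element_of P w) = \<one>\<^bsub>profinite_completion (group_of P)\<^esub>"
      if triv: "trivial_group (profinite_completion (group_of ?Q))"
    proof (rule ccontr)
      assume "\<not> ?thesis"
      then obtain K :: "nat word set set monoid" and f where K: "group K" "finite (carrier K)"
        and f: "f \<in> set (fst P) \<rightarrow> carrier K" "\<forall>r\<in>set (snd P). word_eval K f r = \<one>\<^bsub>K\<^esub>"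
        "word_eval K f w \<noteq> \<one>\<^bsub>K\<^esub>"
        unfolding group_of_def element_of_def
        using finite_group_if_to_profinite_neq_one[OF RP P(2)] by blast
      \<comment> \<open>A finite image in which \<open>w\<close> survives yields a finite image of
        the encoded group in which some generator \<open>x\<close> survives, whereas a trivial
        completion kills \<open>x\<close>.\<close>
      from group.nontrivial_quotient_of_encoding[OF K P f(1) bspec[OF f(2)] f(3)]
      obtain K' :: "((nat word set set \<Rightarrow> bit \<times> bit) \<times> (nat word set set \<Rightarrow> bit \<times> bit) \<Rightarrow>
          (nat word set set \<Rightarrow> bit \<times> bit) \<times> (nat word set set \<Rightarrow> bit \<times> bit)) monoid" and f' x
        where K': "group K'" "finite (carrier K')" "f' \<in> set (fst ?Q) \<rightarrow> carrier K'"
          "\<And>r. r \<in> set (snd ?Q) \<Longrightarrow> word_eval K' f' r = \<one>\<^bsub>K'\<^esub>"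
          and x: "x \<in> set (fst ?Q)" "f' x \<noteq> \<one>\<^bsub>K'\<^esub>"
        by blast
      have "to_profinite (group_of ?Q) (element_of ?Q [(x, True)])
          \<in> carrier (profinite_completion (group_of ?Q))"
        unfolding group_of_def element_of_def
        by (rule hom_in_carrier[OF to_profinite_hom[OF group_presented_group[OF RQ]]
              word_image_in_carrier[OF gen[OF x(1)]]])
      then have "to_profinite (group_of ?Q) (element_of ?Q [(x, True)])
          = \<one>\<^bsub>profinite_completion (group_of ?Q)\<^esub>"
        using triv by (simp add: trivial_group_def)
      then have "word_eval K' f' [(x, True)] = \<one>\<^bsub>K'\<^esub>"
        unfolding group_of_def element_of_def
        by (rule word_eval_eq_one_if_to_profinite_eq_one[OF RQ gen[OF x(1)] _ K'])
      moreover have "f' x \<in> carrier K'" using K'(3) x(1) by blast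
      ultimately show False
        using x(2) group.is_monoid[OF K'(1)] by (simp add: word_eval_Cons letter_eval_def monoid.r_one)
    qed
    moreover have "trivial_group (profinite_completion (group_of ?Q))"
      if w: "to_profinite (group_of P) (element_of P w) = \<one>\<^bsub>profinite_completion (group_of P)\<^esub>"
      unfolding group_of_def
    proof (rule trivial_profinite_completion_if_generators_trivial[OF RQ], rule ccontr)
      fix x assume x: "x \<in> set (fst ?Q)"
        and "to_profinite (presented_group (set (fst ?Q)) (set (snd ?Q)))
          (word_image (set (fst ?Q)) (set (snd ?Q)) [(x, True)])
          \<noteq> \<one>\<^bsub>profinite_completion (presented_group (set (fst ?Q)) (set (snd ?Q)))\<^esub>"
      then obtain K :: "nat word set set monoid" and f where K: "group K" "finite (carrier K)"
        and f: "f \<in> set (fst ?Q) \<rightarrow> carrier K" "\<And>r. r \<in> set (snd ?Q) \<Longrightarrow> word_eval K f r = \<one>\<^bsub>K\<^esub>"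
        "word_eval K f [(x, True)] \<noteq> \<one>\<^bsub>K\<^esub>"
        using finite_group_if_to_profinite_neq_one[OF RQ gen[OF x]] by blast
      interpret K: group K by fact
      \<comment> \<open>On the embedded generators \<open>K\<close> receives a homomorphism from the
        original group, so \<open>w\<close> dies there by hypothesis, and with it the supposedly
        surviving generator \<open>x\<close>.\<close>
      let ?f = "\<lambda>a. f (gen 0 (Suc a))"
      have "?f \<in> set (fst P) \<rightarrow> carrier K"
        using f(1) by (auto simp: encoding_def set_encoding_gens letter_gens_def)
      moreover have "word_eval K ?f r = \<one>\<^bsub>K\<^esub>" if "r \<in> set (snd P)" for r
      proof -
        have "word_eval K f (map embed_letter r) = \<one>\<^bsub>K\<^esub>"
          using that by (intro f(2)) (simp add: encoding_def set_encoding_rels)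
        then show ?thesis by (simp add: embed_letter_def word_eval_map comp_def)
      qed
      ultimately have "word_eval K ?f w = \<one>\<^bsub>K\<^esub>"
        using word_eval_eq_one_if_to_profinite_eq_one[OF RP P(2) _ K] w
        unfolding group_of_def element_of_def by blast
      then have "f x = \<one>\<^bsub>K\<^esub>"
        using K.generators_trivial_if_word_trivial[OF f(1,2) _ x] by blast
      then show False using f(3) by (simp add: word_eval_Cons letter_eval_def)
    qed
    ultimately show ?thesis by blast
  qed
  then show ?thesis
    using p finite_presentation_encoding by blast
qed

end
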